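(* Let $N\ge1$, $0<s<1$, let $\Omega\subset\mathbb{R}^N$ be a bounded domain with Lipschitz continuous boundary, let $\kappa\in L^1(\mathbb{R}^N\setminus\Omega)\cap L^\infty(\mathbb{R}^N\setminus\Omega)$ with $\kappa>0$ a.e. in $\mathbb{R}^N\setminus\Omega$, $d\mu=\kappa\,dx$, $Z_R:=L^2(\mathbb{R}^N\setminus\Omega,\mu)$, and $\xi>0$. Let $Z_{ad,R}$ be a closed and convex subset of $Z_R$ and let $J:L^2(\Omega)\to\mathbb{R}$ be weakly lower-semicontinuous. Let $\mathcal{Z}$ be an open set in $Z_R$ such that $Z_{ad,R}\subset\mathcal{Z}$. Let $u\mapsto J(u):L^2(\Omega)\to\mathbb{R}$ be continuously Fréchet differentiable with $J'(u)\in L^2(\Omega)$. If $\bar z$ is a minimizer over $Z_{ad,R}$ of $$\mathcal{J}(z):=J(Sz)+\frac\xi2\|z\|^2_{L^2(\mathbb{R}^N\setminus\Omega,\mu)},$$ then, with $\bar u:=S\bar z$, the first order necessary optimality conditions are given by $$\int_{\mathbb{R}^N\setminus\Omega}(\bar p+\xi\bar z)(z-\bar z)\,d\mu\ge0\quad\text{for all }z\in Z_{ad,R},\qquad(\ast)$$ where $\bar p\in W^{s,2}_{\Omega,\kappa}$ is the weak solution of the adjoint equation $$(-\Delta)^s\bar p=J'(\bar u)\ \text{ in }\Omega,\qquad\mathcal{N}_s\bar p+\kappa\bar p=0\ \text{ in }\mathbb{R}^N\setminus\Omega.$$ Equivalently, $(\ast)$ can be written as $$\bar z=\mathcal{P}_{Z_{ad,R}}\left(-\frac{\bar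 p}{\xi}\right),$$ where $\mathcal{P}_{Z_{ad,R}}$ is the projection onto the set $Z_{ad,R}$. If $J$ is convex, then $(\ast)$ is a sufficient condition (for $\bar z\in Z_{ad,R}$ to be a minimizer of $\mathcal{J}$ over $Z_{ad,R}$).
   Context: $C_{N,s}:=\frac{s2^{2s}\Gamma\left(\frac{2s+N}{2}\right)}{\pi^{N/2}\Gamma(1-s)}$; $(-\Delta)^su(x)=C_{N,s}\,\mathrm{P.V.}\int_{\mathbb{R}^N}\frac{u(x)-u(y)}{|x-y|^{N+2s}}dy$; $\mathcal{N}_su(x)=C_{N,s}\int_\Omega\frac{u(x)-u(y)}{|x-y|^{N+2s}}dy$ for $x\in\mathbb{R}^N\setminus\overline\Omega$. $\mathbb{R}^{2N}\setminus(\mathbb{R}^N\setminus\Omega)^2:=(\Omega\times\Omega)\cup(\Omega\times(\mathbb{R}^N\setminus\Omega))\cup((\mathbb{R}^N\setminus\Omega)\times\Omega)$. $W^{s,2}_{\Omega,\kappa}$ is the Hilbert space of measurable $u:\mathbb{R}^N\to\mathbb{R}$ with finite norm $$\|u\|_{W^{s,2}_{\Omega,\kappa}}=\left(\|u\|^2_{L^2(\Omega)}+\|u\|^2_{L^2(\mathbb{R}^N\setminus\Omega,\mu)}+\iint_{\mathbb{R}^{2N}\setminus(\mathbb{R}^N\setminus\Omega)^2}\frac{|u(x)-u(y)|^2}{|x-y|^{N+2s}}dxdy\right)^{1/2}.$$ For $w\in L^2(\Omega)$ and $z\in Z_R$, the weak solution of $(-\Delta)^su=w$ in $\Omega$, $\mathcal{N}_su+\kappa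 u=\kappa z$ in $\mathbb{R}^N\setminus\Omega$ is $u\in W^{s,2}_{\Omega,\kappa}$ such that for every $v\in W^{s,2}_{\Omega,\kappa}$ $$\frac{C_{N,s}}{2}\iint_{\mathbb{R}^{2N}\setminus(\mathbb{R}^N\setminus\Omega)^2}\frac{(u(x)-u(y))(v(x)-v(y))}{|x-y|^{N+2s}}dxdy+\int_{\mathbb{R}^N\setminus\Omega}uv\,d\mu=\int_\Omega wv\,dx+\int_{\mathbb{R}^N\setminus\Omega}zv\,d\mu.$$ The control-to-state map $S:Z_R\to L^2(\Omega)$ sends $z$ to the weak solution with $w=0$; it is well-defined, linear and continuous (established in the paper beforehand). $J'(u)$ is identified with an element of $L^2(\Omega)$ via the Riesz representation. *)

theory Defs
  imports "HOL-Analysis.Analysis"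
begin

section \<open>Real $L^2$ spaces\<close>

text \<open>
  Elements of \<open>L2 M\<close> are square integrable functions, not classes modulo equality almost
  everywhere; \<open>L2_norm\<close> is therefore a seminorm, and equality in \<open>L2 M\<close> is equality almost
  everywhere.
  Open and closed sets of the topology below are automatically unions of such classes, and functions
  that are differentiable in the sense of \<open>has_L2_gradient\<close> take one value on each class.
\<close>

definition L2 :: "'a measure \<Rightarrow> ('a \<Rightarrow> real) set" where
  "L2 M = {f \<in> borel_measurable M. integrable M (\<lambda>x. (f x)\<^sup>2)}"

definition L2_inner :: "'a measure \<Rightarrow> ('a \<Rightarrow> real) \<Rightarrow> ('a \<Rightarrow> real) \<Rightarrow> real" where
  "L2_inner M f g = (LINT x|M. f x * g x)"

definition L2_norm :: "'a measure \<Rightarrow> ('a \<Rightarrow> real) \<Rightarrow> real" where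
  "L2_norm M f = sqrt (LINT x|M. (f x)\<^sup>2)"

definition L2_topology :: "'a measure \<Rightarrow> ('a \<Rightarrow> real) topology" where
  "L2_topology M = topology (\<lambda>U. U \<subseteq> L2 M \<and>
     (\<forall>f\<in>U. \<exists>e>0. \<forall>g\<in>L2 M. L2_norm M (\<lambda>x. g x - f x) < e \<longrightarrow> g \<in> U))"

lemma openin_L2_topology:
  "openin (L2_topology M) U \<longleftrightarrow> U \<subseteq> L2 M \<and>
     (\<forall>f\<in>U. \<exists>e>0. \<forall>g\<in>L2 M. L2_norm M (\<lambda>x. g x - f x) < e \<longrightarrow> g \<in> U)"
proof -
  define P where "P = (\<lambda>U. U \<subseteq> L2 M \<and>
     (\<forall>f\<in>U. \<exists>e>0. \<forall>g\<in>L2 M. L2_norm M (\<lambda>x. g x - f x) < e \<longrightarrow> g \<in> U))"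
  have "P (S \<inter> T)" if S: "P S" and T: "P T" for S T
  proof -
    have "\<exists>e>0. \<forall>g\<in>L2 M. L2_norm M (\<lambda>x. g x - f x) < e \<longrightarrow> g \<in> S \<inter> T" if "f \<in> S \<inter> T" for f
    proof -
      obtain d where "d > 0" "\<forall>g\<in>L2 M. L2_norm M (\<lambda>x. g x - f x) < d \<longrightarrow> g \<in> S"
        using S \<open>f \<in> S \<inter> T\<close> by (auto simp: P_def)
      moreover obtain e where "e > 0" "\<forall>g\<in>L2 M. L2_norm M (\<lambda>x. g x - f x) < e \<longrightarrow> g \<in> T"
        using T \<open>f \<in> S \<inter> T\<close> by (auto simp: P_def)
      ultimately show ?thesis
        by (intro exI[of _ "min d e"]) auto
    qed
    then show ?thesis using S by (auto simp: P_def)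
  qed
  moreover have "P (\<Union>K)" if K: "\<forall>S\<in>K. P S" for K
  proof -
    have "\<exists>e>0. \<forall>g\<in>L2 M. L2_norm M (\<lambda>x. g x - f x) < e \<longrightarrow> g \<in> \<Union>K" if "f \<in> S" "S \<in> K" for f S
    proof -
      obtain e where "e > 0" "\<forall>g\<in>L2 M. L2_norm M (\<lambda>x. g x - f x) < e \<longrightarrow> g \<in> S"
        using K \<open>f \<in> S\<close> \<open>S \<in> K\<close> unfolding P_def by blast
      then show ?thesis using \<open>S \<in> K\<close> by blast
    qed
    moreover have "\<Union>K \<subseteq> L2 M" using K by (auto simp: P_def)
    ultimately show ?thesis unfolding P_def by blast
  qed
  ultimately have "istopology P"
    by (auto simp: istopology_def)
  then show ?thesis
    by (simp add: L2_topology_def P_def topology_inverse')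
qed

definition L2_convex_set :: "('a \<Rightarrow> real) set \<Rightarrow> bool" where
  "L2_convex_set K \<longleftrightarrow>
     (\<forall>f\<in>K. \<forall>g\<in>K. \<forall>t\<in>{0..1}. (\<lambda>x. (1 - t) * f x + t * g x) \<in> K)"

definition L2_convex_fun :: "'a measure \<Rightarrow> (('a \<Rightarrow> real) \<Rightarrow> real) \<Rightarrow> bool" where
  "L2_convex_fun M J \<longleftrightarrow>
     (\<forall>f\<in>L2 M. \<forall>g\<in>L2 M. \<forall>t\<in>{0..1}.
        J (\<lambda>x. (1 - t) * f x + t * g x) \<le> (1 - t) * J f + t * J g)"

definition L2_weakly_tendsto :: "'a measure \<Rightarrow> (nat \<Rightarrow> 'a \<Rightarrow> real) \<Rightarrow> ('a \<Rightarrow> real) \<Rightarrow> bool" where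
  "L2_weakly_tendsto M F f \<longleftrightarrow>
     (\<forall>n. F n \<in> L2 M) \<and> f \<in> L2 M \<and>
     (\<forall>g\<in>L2 M. (\<lambda>n. L2_inner M (F n) g) \<longlonglongrightarrow> L2_inner M f g)"

definition L2_weakly_lsc :: "'a measure \<Rightarrow> (('a \<Rightarrow> real) \<Rightarrow> real) \<Rightarrow> bool" where
  "L2_weakly_lsc M J \<longleftrightarrow>
     (\<forall>F f. L2_weakly_tendsto M F f \<longrightarrow> ereal (J f) \<le> liminf (\<lambda>n. ereal (J (F n))))"

text \<open>\<open>g\<close> is the Riesz representative of the Frechet derivative of \<open>J\<close> at \<open>u\<close>.\<close>

definition has_L2_gradient ::
    "'a measure \<Rightarrow> (('a \<Rightarrow> real) \<Rightarrow> real) \<Rightarrow> ('a \<Rightarrow> real) \<Rightarrow> ('a \<Rightarrow> real) \<Rightarrow> bool" where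
  "has_L2_gradient M J g u \<longleftrightarrow> g \<in> L2 M \<and>
     (\<forall>e>0. \<exists>d>0. \<forall>h\<in>L2 M. L2_norm M h < d \<longrightarrow>
        \<bar>J (\<lambda>x. u x + h x) - J u - L2_inner M g h\<bar> \<le> e * L2_norm M h)"

definition L2_C1_with_gradient ::
    "'a measure \<Rightarrow> (('a \<Rightarrow> real) \<Rightarrow> real) \<Rightarrow> (('a \<Rightarrow> real) \<Rightarrow> 'a \<Rightarrow> real) \<Rightarrow> bool" where
  "L2_C1_with_gradient M J J' \<longleftrightarrow>
     (\<forall>u\<in>L2 M. has_L2_gradient M J (J' u) u) \<and>
     continuous_map (L2_topology M) (L2_topology M) J'"

text \<open>Metric projection; determined only up to equality almost everywhere.\<close>

definition L2_proj :: "'a measure \<Rightarrow> ('a \<Rightarrow> real) set \<Rightarrow> ('a \<Rightarrow> real) \<Rightarrow> 'a \<Rightarrow> real" where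
  "L2_proj M K f = (SOME p. p \<in> K \<and>
     (\<forall>q\<in>K. L2_norm M (\<lambda>x. f x - p x) \<le> L2_norm M (\<lambda>x. f x - q x)))"


section \<open>Domains with Lipschitz boundary\<close>

text \<open>
  Near every boundary point the set is the strict epigraph of a Lipschitz function defined on a
  hyperplane; \<open>x - (x \<bullet> e) *\<^sub>R e\<close> is the orthogonal projection of \<open>x\<close> onto that hyperplane.
\<close>

definition lipschitz_boundary :: "'a::euclidean_space set \<Rightarrow> bool" where
  "lipschitz_boundary \<Omega> \<longleftrightarrow>
     (\<forall>x0\<in>frontier \<Omega>. \<exists>e r L \<gamma>. norm e = 1 \<and> 0 < r \<and> L-lipschitz_on {y. y \<bullet> e = 0} \<gamma> \<and>
        (\<forall>x\<in>ball x0 r. x \<in> \<Omega> \<longleftrightarrow> \<gamma> (x - (x \<bullet> e) *\<^sub>R e) < x \<bullet> e))"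


section \<open>The fractional Robin problem\<close>

definition frac_const :: "nat \<Rightarrow> real \<Rightarrow> real" where
  "frac_const N s =
     s * 2 powr (2 * s) * Gamma ((2 * s + real N) / 2) / (pi powr (real N / 2) * Gamma (1 - s))"

definition robin_measure :: "'a::euclidean_space set \<Rightarrow> ('a \<Rightarrow> real) \<Rightarrow> 'a measure" where
  "robin_measure \<Omega> \<kappa> = density (lebesgue_on (- \<Omega>)) (\<lambda>x. ennreal (\<kappa> x))"

definition interaction_region :: "'a set \<Rightarrow> ('a \<times> 'a) set" where
  "interaction_region \<Omega> = \<Omega> \<times> \<Omega> \<union> \<Omega> \<times> (- \<Omega>) \<union> (- \<Omega>) \<times> \<Omega>"

text \<open>On the diagonal, a null set, the integrand is \<open>0 / 0 = 0\<close>.\<close>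

definition gagliardo_integrand ::
    "real \<Rightarrow> ('a::euclidean_space \<Rightarrow> real) \<Rightarrow> ('a \<Rightarrow> real) \<Rightarrow> 'a \<times> 'a \<Rightarrow> real" where
  "gagliardo_integrand s u v =
     (\<lambda>(x, y). (u x - u y) * (v x - v y) / norm (x - y) powr (real DIM('a) + 2 * s))"

text \<open>
  The elements are Lebesgue measurable functions on the whole space; the three integrability
  conditions say that the three summands of the squared norm are finite.
\<close>

definition robin_space :: "real \<Rightarrow> 'a::euclidean_space set \<Rightarrow> ('a \<Rightarrow> real) \<Rightarrow> ('a \<Rightarrow> real) set" where
  "robin_space s \<Omega> \<kappa> =
     {u \<in> borel_measurable lebesgue.
        u \<in> L2 (lebesgue_on \<Omega>) \<and> u \<in> L2 (robin_measure \<Omega> \<kappa>) \<and>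
        set_integrable (lebesgue \<Otimes>\<^sub>M lebesgue) (interaction_region \<Omega>) (gagliardo_integrand s u u)}"

definition robin_weak_solution ::
    "real \<Rightarrow> 'a::euclidean_space set \<Rightarrow> ('a \<Rightarrow> real) \<Rightarrow>
     ('a \<Rightarrow> real) \<Rightarrow> ('a \<Rightarrow> real) \<Rightarrow> ('a \<Rightarrow> real) \<Rightarrow> bool" where
  "robin_weak_solution s \<Omega> \<kappa> w z u \<longleftrightarrow>
     u \<in> robin_space s \<Omega> \<kappa> \<and>
     (\<forall>v\<in>robin_space s \<Omega> \<kappa>.
        frac_const DIM('a) s / 2 *
          set_lebesgue_integral (lebesgue \<Otimes>\<^sub>M lebesgue) (interaction_region \<Omega>)
            (gagliardo_integrand s u v)
        + (LINT x|robin_measure \<Omega> \<kappa>. u x * v x)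
        = (LINT x|lebesgue_on \<Omega>. w x * v x) + (LINT x|robin_measure \<Omega> \<kappa>. z x * v x))"

definition control_to_state ::
    "real \<Rightarrow> 'a::euclidean_space set \<Rightarrow> ('a \<Rightarrow> real) \<Rightarrow> ('a \<Rightarrow> real) \<Rightarrow> 'a \<Rightarrow> real" where
  "control_to_state s \<Omega> \<kappa> z = (SOME u. robin_weak_solution s \<Omega> \<kappa> (\<lambda>_. 0) z u)"

definition reduced_cost ::
    "real \<Rightarrow> 'a::euclidean_space set \<Rightarrow> ('a \<Rightarrow> real) \<Rightarrow> real \<Rightarrow>
     (('a \<Rightarrow> real) \<Rightarrow> real) \<Rightarrow> ('a \<Rightarrow> real) \<Rightarrow> real" where
  "reduced_cost s \<Omega> \<kappa> \<xi> J z =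
     J (control_to_state s \<Omega> \<kappa> z) + \<xi> / 2 * (L2_norm (robin_measure \<Omega> \<kappa>) z)\<^sup>2"

definition is_minimizer_over :: "'b set \<Rightarrow> ('b \<Rightarrow> real) \<Rightarrow> 'b \<Rightarrow> bool" where
  "is_minimizer_over K F x \<longleftrightarrow> x \<in> K \<and> (\<forall>y\<in>K. F x \<le> F y)"

definition variational_inequality ::
    "'a measure \<Rightarrow> ('a \<Rightarrow> real) set \<Rightarrow> real \<Rightarrow> ('a \<Rightarrow> real) \<Rightarrow> ('a \<Rightarrow> real) \<Rightarrow> bool" where
  "variational_inequality M K \<xi> p zbar \<longleftrightarrow>
     (\<forall>z\<in>K. 0 \<le> (LINT x|M. (p x + \<xi> * zbar x) * (z x - zbar x)))"

end

theory Submission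
  imports Defs
begin

text \<open>
  Write \<open>\<E>\<close> for the symmetric bilinear form on the left of the weak formulation, so that \<open>u\<close> is
  the weak solution with data \<open>w\<close>, \<open>z\<close> if \<open>\<E> u v = \<langle>w, v\<rangle> + \<langle>z, v\<rangle>\<close> for all test functions,
  the pairings being those of $L^2(\Omega)$ and $L^2(\mu)$.  Since the form is symmetric, testing the
  adjoint equation with \<open>S y - S z\<close> and the state equations with \<open>p\<close> gives
  \<open>\<langle>J' (S z), S y - S z\<rangle> = \<langle>p, y - z\<rangle>\<close> (\<open>adjoint_identity\<close>).  The derivative of the
  reduced cost at \<open>z\<close> in direction \<open>y - z\<close> is therefore \<open>\<langle>p + \<xi> z, y - z\<rangle>\<close>.  At a minimizer
  over a convex set this is nonnegative, because the difference quotients along segments are;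
  conversely, if \<open>J\<close> is convex, it lies above its tangent, and nonnegativity of the derivative
  yields minimality.  Dividing by \<open>\<xi>\<close> turns the variational inequality into the
  characterization of the nearest point of a convex set to \<open>- p / \<xi>\<close>.

  What has to be supplied is the solvability of the weak problem and the existence of the metric
  projection.  Both are minimizations of a quadratic functional \<open>B u u - 2 L u\<close> over a convex set that
  is complete for the seminorm of \<open>B\<close>: the parallelogram law makes a suitable minimizing sequence
  Cauchy (\<open>minimizer_exists\<close>).  Completeness comes from almost everywhere convergence of rapidly
  Cauchy sequences and Fatou's lemma.

  The form \<open>\<E>\<close> contains no integral of $u^2$ over \<open>\<Omega>\<close>, so one needs a Poincare inequality
  (\<open>energy_controls_L2\<close>).  It has an elementary proof without compactness: choose a bounded set \<open>A\<close>
  of positive measure outside \<open>\<Omega>\<close> on which \<open>\<kappa> \<ge> \<delta> > 0\<close>, and average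
  $u(x)^2 \le 2 (u(x) - u(y))^2 + 2 u(y)^2$ over $y \in A$.  The kernel $|x - y|^{-N-2s}$ is bounded
  below on \<open>\<Omega> \<times> A\<close>, so the first term is controlled by the nonlocal energy and the second by the
  boundary term.
\<close>

section \<open>Quadratic functionals on semi-inner product spaces\<close>

text \<open>
  The form is only semidefinite because functions that agree almost everywhere are not identified.
  Vectors are functions with pointwise operations, and the carrier \<open>V\<close> is explicit, so that both
  $L^2$ and the energy space are instances.
\<close>

locale semi_inner_product_space =
  fixes V :: "('a \<Rightarrow> real) set"
    and B :: "('a \<Rightarrow> real) \<Rightarrow> ('a \<Rightarrow> real) \<Rightarrow> real"
  assumes add_closed: "\<lbrakk>f \<in> V; g \<in> V\<rbrakk> \<Longrightarrow> (\<lambda>x. f x + g x) \<in> V"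
    and scale_closed: "f \<in> V \<Longrightarrow> (\<lambda>x. c * f x) \<in> V"
    and add_left: "\<lbrakk>f \<in> V; g \<in> V; h \<in> V\<rbrakk> \<Longrightarrow> B (\<lambda>x. f x + g x) h = B f h + B g h"
    and scale_left: "\<lbrakk>f \<in> V; h \<in> V\<rbrakk> \<Longrightarrow> B (\<lambda>x. c * f x) h = c * B f h"
    and sym: "\<lbrakk>f \<in> V; g \<in> V\<rbrakk> \<Longrightarrow> B f g = B g f"
    and nonneg: "f \<in> V \<Longrightarrow> 0 \<le> B f f"
begin

lemma add_right: "\<lbrakk>f \<in> V; g \<in> V; h \<in> V\<rbrakk> \<Longrightarrow> B h (\<lambda>x. f x + g x) = B h f + B h g"
  by (simp add: sym[of h] add_left add_closed)

lemma scale_right: "\<lbrakk>f \<in> V; h \<in> V\<rbrakk> \<Longrightarrow> B h (\<lambda>x. c * f x) = c * B h f"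
  by (simp add: sym[of h] scale_left scale_closed)

lemma diff_closed: "\<lbrakk>f \<in> V; g \<in> V\<rbrakk> \<Longrightarrow> (\<lambda>x. f x - g x) \<in> V"
  using add_closed[OF _ scale_closed[of g "-1"], of f] by simp

lemma diff_left: "\<lbrakk>f \<in> V; g \<in> V; h \<in> V\<rbrakk> \<Longrightarrow> B (\<lambda>x. f x - g x) h = B f h - B g h"
  using add_left[OF _ scale_closed[of g "-1"], of f h] scale_left[of g h "-1"] by simp

lemma diff_right: "\<lbrakk>f \<in> V; g \<in> V; h \<in> V\<rbrakk> \<Longrightarrow> B h (\<lambda>x. f x - g x) = B h f - B h g"
  by (simp add: sym[of h] diff_left diff_closed)

lemmas bilinear = add_left add_right scale_left scale_right diff_left diff_right
  add_closed scale_closed diff_closed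

text \<open>
  The quadratic polynomial $t \mapsto B(f + t g, f + t g)$ is nonnegative.  If its leading coefficient
  vanishes, which does not force \<open>g\<close> to be zero, it is affine and hence constant.
\<close>

lemma Cauchy_Schwarz:
  assumes f: "f \<in> V" and g: "g \<in> V"
  shows "(B f g)\<^sup>2 \<le> B f f * B g g"
proof -
  have q: "0 \<le> B f f + 2 * t * B f g + t\<^sup>2 * B g g" for t
    using nonneg[of "\<lambda>x. f x + t * g x"] f g sym[of g f]
    by (simp add: bilinear algebra_simps power2_eq_square)
  show ?thesis
  proof (cases "B g g = 0")
    case True
    have "B f g = 0"
    proof (rule ccontr)
      assume "B f g \<noteq> 0"
      \<comment> \<open>This value of the parameter makes the affine function equal to \<open>- 1\<close>.\<close>
      then have "2 * (- (B f f + 1) / (2 * B f g)) * B f g = - (B f f + 1)"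
        by (simp add: field_simps)
      then show False using q[of "- (B f f + 1) / (2 * B f g)"] True by simp
    qed
    then show ?thesis using True by simp
  next
    case False
    then have "B g g > 0" using nonneg[OF g] by simp
    then show ?thesis
      using q[of "- B f g / B g g"] by (simp add: field_simps power2_eq_square)
  qed
qed

text \<open>
  Completeness is required only for sequences with a geometric rate.  Any Cauchy sequence has such a
  subsequence, so this is no restriction, and the rate makes almost everywhere convergence
  available without passing to subsequences.
\<close>

definition complete_subset :: "('a \<Rightarrow> real) set \<Rightarrow> bool" where
  "complete_subset K \<longleftrightarrow> (\<forall>F. (\<forall>n. F n \<in> K) \<and>
     (\<forall>m n. m \<le> n \<longrightarrow> B (\<lambda>x. F n x - F m x) (\<lambda>x. F n x - F m x) \<le> (1/4) ^ m) \<longrightarrow>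
     (\<exists>f\<in>K. (\<lambda>n. B (\<lambda>x. F n x - f x) (\<lambda>x. F n x - f x)) \<longlonglongrightarrow> 0))"

text \<open>
  Moving from \<open>u\<close> towards \<open>v\<close> by a fraction \<open>t\<close> changes the functional by
  $t\,(2 (B(u,d) - L d) + t B(d,d))$ with \<open>d = v - u\<close>; divide by \<open>t\<close> and let it tend to zero.
\<close>

lemma minimizer_imp_variational_inequality:
  assumes K: "K \<subseteq> V" "L2_convex_set K" and u: "u \<in> K" and v: "v \<in> K"
    and L: "\<And>f g. f \<in> V \<Longrightarrow> g \<in> V \<Longrightarrow> L (\<lambda>x. f x + g x) = L f + L g"
      "\<And>f c. f \<in> V \<Longrightarrow> L (\<lambda>x. c * f x) = c * L f"
    and min: "\<And>w. w \<in> K \<Longrightarrow> B u u - 2 * L u \<le> B w w - 2 * L w"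
  shows "L (\<lambda>x. v x - u x) \<le> B u (\<lambda>x. v x - u x)"
proof -
  define d where "d = (\<lambda>x. v x - u x)"
  have V: "u \<in> V" "v \<in> V" "d \<in> V" using K u v by (auto simp: d_def intro!: diff_closed)
  have *: "0 \<le> 2 * (B u d - L d) + t * B d d" if t: "0 < t" "t < 1" for t
  proof -
    have eq: "(\<lambda>x. (1 - t) * u x + t * v x) = (\<lambda>x. u x + t * d x)"
      by (auto simp: d_def algebra_simps)
    have "(\<lambda>x. u x + t * d x) \<in> K"
      using K(2) u v t unfolding L2_convex_set_def eq[symmetric] by auto
    from min[OF this] have "0 \<le> t * (2 * (B u d - L d) + t * B d d)"
      using V sym[of d u] by (simp add: bilinear L algebra_simps)
    then show ?thesis using t by (simp add: zero_le_mult_iff)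
  qed
  have "((\<lambda>t. 2 * (B u d - L d) + t * B d d) \<longlongrightarrow> 2 * (B u d - L d) + 0 * B d d) (at_right 0)"
    by (intro tendsto_intros)
  moreover have "eventually (\<lambda>t. 0 \<le> 2 * (B u d - L d) + t * B d d) (at_right 0)"
    by (rule eventually_mono[OF eventually_at_right_real[OF zero_less_one]]) (use * in auto)
  ultimately have "0 \<le> 2 * (B u d - L d) + 0 * B d d"
    by (intro tendsto_lowerbound) auto
  then show ?thesis by (simp add: d_def)
qed

text \<open>
  Boundedness of \<open>L\<close> makes the functional \<open>Q\<close> bounded below on \<open>K\<close>.  By the parallelogram law,
  $B(u - w, u - w) = 2 (Q u + Q w - 2 Q ((u + w)/2))$, so near-minimizers are close to each other; the
  limit of a sequence of near-minimizers is a minimizer because \<open>Q\<close> is continuous.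
\<close>

lemma minimizer_exists:
  assumes K: "K \<subseteq> V" "L2_convex_set K" "K \<noteq> {}" and compl: "complete_subset K"
    and L: "\<And>f g. f \<in> V \<Longrightarrow> g \<in> V \<Longrightarrow> L (\<lambda>x. f x + g x) = L f + L g"
      "\<And>f c. f \<in> V \<Longrightarrow> L (\<lambda>x. c * f x) = c * L f"
    and bounded: "\<And>f. f \<in> V \<Longrightarrow> (L f)\<^sup>2 \<le> C * B f f"
  shows "\<exists>u\<in>K. \<forall>w\<in>K. B u u - 2 * L u \<le> B w w - 2 * L w"
proof -
  define Q where "Q w = B w w - 2 * L w" for w
  have L_le: "2 * \<bar>L f\<bar> \<le> B f f + \<bar>C\<bar>" if f: "f \<in> V" for f
  proof -
    have "(L f)\<^sup>2 \<le> \<bar>C\<bar> * B f f"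
      using bounded[OF f] nonneg[OF f] by (meson abs_ge_self mult_right_mono order_trans)
    moreover have "4 * (\<bar>C\<bar> * B f f) \<le> (B f f + \<bar>C\<bar>)\<^sup>2"
      using zero_le_power2[of "B f f - \<bar>C\<bar>"] by (simp add: power2_eq_square algebra_simps)
    ultimately have "(2 * \<bar>L f\<bar>)\<^sup>2 \<le> (B f f + \<bar>C\<bar>)\<^sup>2"
      by (simp add: power_mult_distrib)
    then show ?thesis
      using nonneg[OF f] power2_le_imp_le[of "2 * \<bar>L f\<bar>" "B f f + \<bar>C\<bar>"] by simp
  qed
  have Q_ge: "- \<bar>C\<bar> \<le> Q f" if "f \<in> V" for f
    using L_le[OF that] by (simp add: Q_def)
  define m where "m = Inf (Q ` K)"
  have bdd: "bdd_below (Q ` K)"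
    using Q_ge K(1) by (auto intro!: bdd_belowI[of _ "-\<bar>C\<bar>"])
  have m_le: "m \<le> Q w" if "w \<in> K" for w
    unfolding m_def using bdd that by (simp add: cInf_lower)
  \<comment> \<open>Squared distances are at most four times the larger excess over \<open>m\<close>; hence the division of \<open>(1/4) ^ n\<close> by 4.\<close>
  have "\<exists>w\<in>K. Q w < m + (1/4) ^ n / 4" for n
    using cInf_lessD[of "Q ` K" "m + (1/4) ^ n / 4"] K(3) by (auto simp: m_def)
  then obtain F where F: "\<And>n. F n \<in> K" "\<And>n. Q (F n) < m + (1/4) ^ n / 4"
    by metis
  have FV: "F n \<in> V" for n using F K by auto
  have "\<forall>k n. k \<le> n \<longrightarrow> B (\<lambda>x. F n x - F k x) (\<lambda>x. F n x - F k x) \<le> (1/4) ^ k"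
  proof (intro allI impI)
    fix k n :: nat assume that: "k \<le> n"
    define h :: real where "h = 1/2"
    define w where "w = (\<lambda>x. h * F n x + h * F k x)"
    have "h \<in> {0..1}" by (simp add: h_def)
    then have "(\<lambda>x. (1 - h) * F n x + h * F k x) \<in> K"
      using K(2) F(1) unfolding L2_convex_set_def by blast
    then have "w \<in> K" by (simp add: w_def h_def)
    have "Q w = h * h * (B (F n) (F n) + 2 * B (F n) (F k) + B (F k) (F k)) - 2 * h * (L (F n) + L (F k))"
      using FV[of n] FV[of k] sym[of "F k" "F n"]
      by (simp add: Q_def w_def bilinear L algebra_simps)
    then have "B (\<lambda>x. F n x - F k x) (\<lambda>x. F n x - F k x) = 2 * (Q (F n) + Q (F k) - 2 * Q w)"
      using FV[of n] FV[of k] sym[of "F k" "F n"]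
      by (simp add: Q_def bilinear h_def add_divide_distrib)
    then have "B (\<lambda>x. F n x - F k x) (\<lambda>x. F n x - F k x) \<le> 2 * (Q (F n) + Q (F k) - 2 * m)"
      using m_le[OF \<open>w \<in> K\<close>] by simp
    moreover have "(1/4 :: real) ^ n \<le> (1/4) ^ k" by (rule power_decreasing[OF that]) auto
    moreover have "b \<le> q" if "b \<le> 2 * (x + y - 2 * m)" "p \<le> q" "x < m + p / 4" "y < m + q / 4"
      for b x y p q :: real
      using that by (simp add: field_simps)
    ultimately show "B (\<lambda>x. F n x - F k x) (\<lambda>x. F n x - F k x) \<le> (1/4) ^ k" using F(2) by blast
  qed
  then obtain f where f: "f \<in> K" and lim: "(\<lambda>n. B (\<lambda>x. F n x - f x) (\<lambda>x. F n x - f x)) \<longlonglongrightarrow> 0"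
    using compl[unfolded complete_subset_def, THEN spec[of _ F], THEN mp, OF conjI] F(1) by blast
  have fV: "f \<in> V" using f K by auto
  define d where "d n = (\<lambda>x. F n x - f x)" for n
  have dV: "d n \<in> V" for n unfolding d_def by (intro diff_closed FV fV)
  have QF: "Q (F n) = Q f + 2 * B f (d n) + B (d n) (d n) - 2 * L (d n)" for n
  proof -
    have "F n = (\<lambda>x. f x + d n x)" by (simp add: d_def)
    then show ?thesis using fV dV[of n] sym[of "d n" f] by (simp add: Q_def bilinear L)
  qed
  have lim': "(\<lambda>n. B (d n) (d n)) \<longlonglongrightarrow> 0" using lim by (simp add: d_def)
  have null: "X \<longlonglongrightarrow> 0" if "\<And>n. (X n)\<^sup>2 \<le> c * B (d n) (d n)" for X :: "nat \<Rightarrow> real" and c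
  proof -
    have "(\<lambda>n. c * B (d n) (d n)) \<longlonglongrightarrow> 0" using tendsto_mult_right_zero[OF lim'] .
    from tendsto_sandwich[OF _ _ tendsto_const this, of "\<lambda>n. (X n)\<^sup>2"]
    have "(\<lambda>n. (X n)\<^sup>2) \<longlonglongrightarrow> 0" using that by simp
    then show ?thesis by (simp add: power_tendsto_0_iff)
  qed
  have "(\<lambda>n. B f (d n)) \<longlonglongrightarrow> 0" "(\<lambda>n. L (d n)) \<longlonglongrightarrow> 0"
    using null[OF Cauchy_Schwarz[OF fV dV]] null[OF bounded[OF dV]] by blast+
  then have "(\<lambda>n. Q (F n)) \<longlonglongrightarrow> Q f + 2 * 0 + 0 - 2 * 0"
    unfolding QF by (intro tendsto_intros lim')
  moreover have "(\<lambda>n. m + (1/4) ^ n / 4) \<longlonglongrightarrow> m + 0 / 4"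
    by (intro tendsto_intros LIMSEQ_power_zero) auto
  ultimately have "Q f + 2 * 0 + 0 - 2 * 0 \<le> m + 0 / 4"
    using F(2) by (intro LIMSEQ_le[of "\<lambda>n. Q (F n)" _ "\<lambda>n. m + (1/4) ^ n / 4"]) (auto intro: less_imp_le)
  then have "Q f \<le> Q w" if "w \<in> K" for w using m_le[OF that] by simp
  with f show ?thesis unfolding Q_def by blast
qed

text \<open>
  On the whole space the variational inequality may be tested with \<open>v\<close> and with \<open>- v\<close>, which turns
  it into an equation.
\<close>

lemma Riesz_representation:
  assumes "V \<noteq> {}" and compl: "complete_subset V"
    and L: "\<And>f g. f \<in> V \<Longrightarrow> g \<in> V \<Longrightarrow> L (\<lambda>x. f x + g x) = L f + L g"
      "\<And>f c. f \<in> V \<Longrightarrow> L (\<lambda>x. c * f x) = c * L f"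
    and bounded: "\<And>f. f \<in> V \<Longrightarrow> (L f)\<^sup>2 \<le> C * B f f"
  obtains u where "u \<in> V" "\<And>v. v \<in> V \<Longrightarrow> B u v = L v"
proof -
  have conv: "L2_convex_set V" by (auto simp: L2_convex_set_def add_closed scale_closed)
  have "\<exists>u\<in>V. \<forall>w\<in>V. B u u - 2 * L u \<le> B w w - 2 * L w"
    by (rule minimizer_exists[of V L C, OF order_refl conv assms(1) compl L bounded])
  then obtain u where u: "u \<in> V" and min: "\<And>w. w \<in> V \<Longrightarrow> B u u - 2 * L u \<le> B w w - 2 * L w"
    by blast
  have le: "L v \<le> B u v" if "v \<in> V" for v
  proof -
    have "L (\<lambda>x. u x + v x - u x) \<le> B u (\<lambda>x. u x + v x - u x)"
      by (rule minimizer_imp_variational_inequality[of V u _ L,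
            OF order_refl conv u add_closed[OF u that] L min])
    then show ?thesis by simp
  qed
  have "B u v = L v" if v: "v \<in> V" for v
    using le[OF v] le[OF scale_closed[OF v, of "-1"]] L(2)[OF v, of "-1"] scale_right[OF v u, of "-1"]
    by linarith
  with u show ?thesis by (rule that)
qed

end

section \<open>Completeness of $L^2$\<close>

lemma L2_D: "f \<in> L2 M \<Longrightarrow> f \<in> borel_measurable M" "f \<in> L2 M \<Longrightarrow> integrable M (\<lambda>x. (f x)\<^sup>2)"
  by (auto simp: L2_def)

text \<open>
  $|f g| \le f^2 + g^2$.
\<close>

lemma integrable_L2_mult:
  assumes "f \<in> L2 M" "g \<in> L2 M"
  shows "integrable M (\<lambda>x. f x * g x)"
proof (rule Bochner_Integration.integrable_bound)
  show "integrable M (\<lambda>x. (f x)\<^sup>2 + (g x)\<^sup>2)" using assms by (auto dest: L2_D)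
  show "(\<lambda>x. f x * g x) \<in> borel_measurable M"
    using L2_D(1)[OF assms(1)] L2_D(1)[OF assms(2)] by measurable
  have "\<bar>a * b\<bar> \<le> a\<^sup>2 + b\<^sup>2" for a b :: real
  proof -
    have "2 * (\<bar>a\<bar> * \<bar>b\<bar>) \<le> a\<^sup>2 + b\<^sup>2" "0 \<le> \<bar>a\<bar> * \<bar>b\<bar>"
      using sum_squares_bound[of "\<bar>a\<bar>" "\<bar>b\<bar>"] by (simp_all add: mult.assoc)
    then show ?thesis unfolding abs_mult by linarith
  qed
  then show "AE x in M. norm (f x * g x) \<le> norm ((f x)\<^sup>2 + (g x)\<^sup>2)" by simp
qed

lemma L2_add: "f \<in> L2 M \<Longrightarrow> g \<in> L2 M \<Longrightarrow> (\<lambda>x. f x + g x) \<in> L2 M"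
  using integrable_L2_mult[of f M g]
  by (auto simp: L2_def power2_sum mult.assoc)

lemma L2_scale: "f \<in> L2 M \<Longrightarrow> (\<lambda>x. c * f x) \<in> L2 M"
  by (auto simp: L2_def power_mult_distrib)

interpretation L2: semi_inner_product_space "L2 M" "L2_inner M" for M
proof
  fix f g h :: "'a \<Rightarrow> real" and c :: real
  assume f: "f \<in> L2 M" and h: "h \<in> L2 M"
  show "L2_inner M (\<lambda>x. f x + g x) h = L2_inner M f h + L2_inner M g h" if "g \<in> L2 M"
    using integrable_L2_mult[OF f h] integrable_L2_mult[OF that h]
    by (simp add: L2_inner_def ring_distribs)
  show "L2_inner M (\<lambda>x. c * f x) h = c * L2_inner M f h"
    by (simp add: L2_inner_def mult.assoc)
qed (auto simp: L2_add L2_scale L2_inner_def mult.commute)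

lemma L2_norm_eq_sqrt_inner: "L2_norm M f = sqrt (L2_inner M f f)"
  by (simp add: L2_norm_def L2_inner_def power2_eq_square)

lemma L2_norm_nonneg: "0 \<le> L2_norm M f"
  by (simp add: L2_norm_def)

lemma L2_norm_square: "(L2_norm M f)\<^sup>2 = L2_inner M f f"
  by (simp add: L2_norm_def L2_inner_def power2_eq_square)

lemma L2_inner_self_eq_0_iff:
  assumes "f \<in> L2 M"
  shows "L2_inner M f f = 0 \<longleftrightarrow> (AE x in M. f x = 0)"
  using integral_nonneg_eq_0_iff_AE[of M "\<lambda>x. (f x)\<^sup>2"] L2_D(2)[OF assms]
  by (simp add: L2_inner_def power2_eq_square)

lemma nn_integral_square_L2:
  assumes "f \<in> L2 M"
  shows "(\<integral>\<^sup>+x. ennreal ((f x)\<^sup>2) \<partial>M) = ennreal (L2_inner M f f)"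
  using nn_integral_eq_integral[OF L2_D(2)[OF assms]] by (simp add: L2_inner_def power2_eq_square)

lemma L2_if_nn_integral_le:
  assumes f: "f \<in> borel_measurable M" and le: "(\<integral>\<^sup>+x. ennreal ((f x)\<^sup>2) \<partial>M) \<le> ennreal c"
    and c: "0 \<le> c"
  shows "f \<in> L2 M" and "L2_inner M f f \<le> c"
proof -
  have "integrable M (\<lambda>x. (f x)\<^sup>2)"
    using f le by (intro integrableI_nonneg) (auto intro: le_less_trans)
  with f show "f \<in> L2 M" by (simp add: L2_def)
  then show "L2_inner M f f \<le> c" using le c by (simp add: nn_integral_square_L2)
qed

text \<open>
  With \<open>d n\<close> the increments, the series of $2^n \|d_n\|^2$ converges, so the series of
  $2^n d_n(x)^2$ is finite for almost every \<open>x\<close>.  This bounds the increments there by a summable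
  sequence, since $|d| \le 2^{-n} + 2^n d^2$ for every real \<open>d\<close>.
\<close>

lemma fast_Cauchy_AE_convergent:
  assumes F: "\<And>n. F n \<in> L2 M"
    and fast: "\<And>n. L2_inner M (\<lambda>x. F (Suc n) x - F n x) (\<lambda>x. F (Suc n) x - F n x) \<le> c * (1/4) ^ n"
    and c: "0 \<le> c"
  shows "AE x in M. convergent (\<lambda>n. F n x)"
proof -
  define d where "d n = (\<lambda>x. F (Suc n) x - F n x)" for n
  have d: "d n \<in> L2 M" for n unfolding d_def by (intro L2.diff_closed F)
  note [measurable] = L2_D(1)[OF d]
  have "(\<integral>\<^sup>+x. (\<Sum>n. ennreal (2 ^ n * (d n x)\<^sup>2)) \<partial>M) = (\<Sum>n. \<integral>\<^sup>+x. ennreal (2 ^ n * (d n x)\<^sup>2) \<partial>M)"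
    by (intro nn_integral_suminf) measurable
  also have "\<dots> \<le> (\<Sum>n. ennreal (c * (1/2) ^ n))"
  proof (intro suminf_le summableI)
    fix n
    have "(\<integral>\<^sup>+x. ennreal (2 ^ n * (d n x)\<^sup>2) \<partial>M) = ennreal (2 ^ n) * (\<integral>\<^sup>+x. ennreal ((d n x)\<^sup>2) \<partial>M)"
      by (subst nn_integral_cmult[symmetric]) (auto simp: ennreal_mult)
    also have "\<dots> = ennreal (2 ^ n * L2_inner M (d n) (d n))"
      by (simp add: nn_integral_square_L2[OF d] ennreal_mult L2.nonneg[OF d])
    also have "\<dots> \<le> ennreal (2 ^ n * (c * (1/4) ^ n))"
      using fast[of n] by (intro ennreal_leI mult_left_mono) (auto simp: d_def)
    also have "2 ^ n * (c * (1/4) ^ n) = c * (2 * (1/4)) ^ n"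
      unfolding power_mult_distrib by simp
    finally show "(\<integral>\<^sup>+x. ennreal (2 ^ n * (d n x)\<^sup>2) \<partial>M) \<le> ennreal (c * (1/2) ^ n)" by simp
  qed
  also have "\<dots> = ennreal (\<Sum>n. c * (1/2) ^ n)"
    using c by (intro suminf_ennreal2 summable_mult summable_geometric) auto
  also have "\<dots> < \<infinity>" by simp
  finally have "AE x in M. (\<Sum>n. ennreal (2 ^ n * (d n x)\<^sup>2)) \<noteq> \<infinity>"
    by (intro nn_integral_PInf_AE) auto
  then show ?thesis
  proof (rule AE_mp, intro AE_I2 impI)
    fix x
    assume "(\<Sum>n. ennreal (2 ^ n * (d n x)\<^sup>2)) \<noteq> \<infinity>"
    then have sq: "summable (\<lambda>n. 2 ^ n * (d n x)\<^sup>2)"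
      by (intro summable_suminf_not_top) auto
    have "summable (\<lambda>n. (1/2) ^ n + 2 ^ n * (d n x)\<^sup>2)"
      by (intro summable_add sq summable_geometric) auto
    then have "summable (\<lambda>n. d n x)"
    proof (rule summable_comparison_test')
      fix n :: nat
      show "norm (d n x) \<le> (1/2) ^ n + 2 ^ n * (d n x)\<^sup>2"
      proof (cases "\<bar>d n x\<bar> \<le> (1/2) ^ n")
        case True
        then show ?thesis by (simp add: add_increasing2)
      next
        case False
        then have "1 \<le> 2 ^ n * \<bar>d n x\<bar>" by (simp add: field_simps power_one_over)
        then have "1 * \<bar>d n x\<bar> \<le> (2 ^ n * \<bar>d n x\<bar>) * \<bar>d n x\<bar>" by (intro mult_right_mono) auto
        moreover have "(2 ^ n * \<bar>d n x\<bar>) * \<bar>d n x\<bar> = 2 ^ n * (d n x)\<^sup>2"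
          by (simp add: power2_eq_square mult.assoc)
        moreover have "0 \<le> (1/2 :: real) ^ n" by simp
        ultimately show ?thesis unfolding real_norm_def by linarith
      qed
    qed
    then have "convergent (\<lambda>n. (\<Sum>k<n. d k x) + F 0 x)"
      unfolding summable_iff_convergent by (intro convergent_add convergent_const)
    then show "convergent (\<lambda>n. F n x)"
      by (simp add: d_def sum_lessThan_telescope[of "\<lambda>n. F n x"])
  qed
qed

text \<open>
  Fatou's lemma applied to $(F_n - F_m)^2$ as \<open>n\<close> tends to infinity.  The rate survives in the limit.
\<close>

lemma L2_fast_Cauchy_AE_limit:
  assumes F: "\<And>n. F n \<in> L2 M" and f: "f \<in> borel_measurable M"
    and lim: "AE x in M. (\<lambda>n. F n x) \<longlonglongrightarrow> f x"
    and fast: "\<And>m n. m \<le> n \<Longrightarrow> L2_inner M (\<lambda>x. F n x - F m x) (\<lambda>x. F n x - F m x) \<le> c * (1/4) ^ m"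
    and c: "0 \<le> c"
  shows "f \<in> L2 M" and "L2_inner M (\<lambda>x. F m x - f x) (\<lambda>x. F m x - f x) \<le> c * (1/4) ^ m"
proof -
  note [measurable] = f L2_D(1)[OF F]
  have nn: "(\<integral>\<^sup>+x. ennreal ((F m x - f x)\<^sup>2) \<partial>M) \<le> ennreal (c * (1/4) ^ m)" for m
  proof -
    have "(\<integral>\<^sup>+x. ennreal ((F m x - f x)\<^sup>2) \<partial>M) = (\<integral>\<^sup>+x. liminf (\<lambda>n. ennreal ((F n x - F m x)\<^sup>2)) \<partial>M)"
    proof (rule nn_integral_cong_AE, use lim in eventually_elim)
      case (elim x)
      then have "(\<lambda>n. ennreal ((F n x - F m x)\<^sup>2)) \<longlonglongrightarrow> ennreal ((f x - F m x)\<^sup>2)"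
        by (intro tendsto_intros tendsto_ennrealI)
      from lim_imp_Liminf[OF _ this] show ?case
        by (simp add: power2_commute)
    qed
    also have "\<dots> \<le> liminf (\<lambda>n. \<integral>\<^sup>+x. ennreal ((F n x - F m x)\<^sup>2) \<partial>M)"
      by (intro nn_integral_liminf) measurable
    also have "\<dots> \<le> liminf (\<lambda>n. ennreal (c * (1/4) ^ m))"
    proof (intro Liminf_mono eventually_sequentiallyI[of m])
      fix n assume "m \<le> n"
      then show "(\<integral>\<^sup>+x. ennreal ((F n x - F m x)\<^sup>2) \<partial>M) \<le> ennreal (c * (1/4) ^ m)"
        unfolding nn_integral_square_L2[OF L2.diff_closed[OF F F]]
        using fast by (intro ennreal_leI)
    qed
    also have "\<dots> = ennreal (c * (1/4) ^ m)" by (simp add: Liminf_const)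
    finally show ?thesis .
  qed
  have diff: "(\<lambda>x. F m x - f x) \<in> L2 M" for m
    by (rule L2_if_nn_integral_le(1)[OF _ nn]) (use c in auto)
  show "L2_inner M (\<lambda>x. F m x - f x) (\<lambda>x. F m x - f x) \<le> c * (1/4) ^ m"
    by (rule L2_if_nn_integral_le(2)[OF _ nn]) (use c in auto)
  show "f \<in> L2 M"
    using L2.diff_closed[OF F[of 0] diff[of 0]] by simp
qed

lemma closedin_L2_subset: "closedin (L2_topology M) K \<Longrightarrow> K \<subseteq> L2 M"
  using openin_topspace[of "L2_topology M"] closedin_subset[of "L2_topology M" K]
  unfolding openin_L2_topology by blast

lemma closedin_L2_limit:
  assumes K: "closedin (L2_topology M) K" and F: "\<And>n. F n \<in> K" and f: "f \<in> L2 M"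
    and lim: "(\<lambda>n. L2_inner M (\<lambda>x. F n x - f x) (\<lambda>x. F n x - f x)) \<longlonglongrightarrow> 0"
  shows "f \<in> K"
proof (rule ccontr)
  assume "f \<notin> K"
  have "L2 M \<subseteq> topspace (L2_topology M)"
    by (intro openin_subset) (auto simp: openin_L2_topology intro: exI[of _ "1 :: real"])
  with f \<open>f \<notin> K\<close> have "f \<in> topspace (L2_topology M) - K" by auto
  moreover have "openin (L2_topology M) (topspace (L2_topology M) - K)"
    using K by (simp add: closedin_def)
  ultimately obtain e where "e > 0"
    and e: "\<And>g. g \<in> L2 M \<Longrightarrow> L2_norm M (\<lambda>x. g x - f x) < e \<Longrightarrow> g \<notin> K"
    unfolding openin_L2_topology by blast
  have "(\<lambda>n. L2_norm M (\<lambda>x. F n x - f x)) \<longlonglongrightarrow> 0"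
    using tendsto_real_sqrt[OF lim] by (simp add: L2_norm_eq_sqrt_inner)
  then have "eventually (\<lambda>n. L2_norm M (\<lambda>x. F n x - f x) < e) sequentially"
    using \<open>e > 0\<close> by (rule order_tendstoD)
  then obtain n where "L2_norm M (\<lambda>x. F n x - f x) < e"
    unfolding eventually_sequentially by blast
  moreover have "F n \<in> L2 M" using F closedin_L2_subset[OF K] by blast
  ultimately show False using e F by blast
qed

text \<open>
  The pointwise limit is a candidate on the set of convergence; elsewhere \<open>lim\<close> has an unspecified
  value, which affects only a null set.
\<close>

lemma closedin_L2_complete:
  assumes K: "closedin (L2_topology M) K"
  shows "L2.complete_subset M K"
  unfolding L2.complete_subset_def
proof (intro allI impI, elim conjE)
  fix F
  assume F: "\<forall>n. F n \<in> K"
    and fast: "\<forall>m n. m \<le> n \<longrightarrow> L2_inner M (\<lambda>x. F n x - F m x) (\<lambda>x. F n x - F m x) \<le> (1/4) ^ m"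
  have FL: "F n \<in> L2 M" for n using F closedin_L2_subset[OF K] by blast
  define f where "f x = lim (\<lambda>n. F n x)" for x
  have f: "f \<in> borel_measurable M"
    unfolding f_def using L2_D(1)[OF FL] by (rule borel_measurable_lim_metric)
  have "AE x in M. convergent (\<lambda>n. F n x)"
    using FL fast by (intro fast_Cauchy_AE_convergent[where c = 1]) auto
  then have lim: "AE x in M. (\<lambda>n. F n x) \<longlonglongrightarrow> f x"
    by eventually_elim (simp add: f_def convergent_LIMSEQ_iff)
  have fL: "f \<in> L2 M"
    using fast by (intro L2_fast_Cauchy_AE_limit(1)[OF FL f lim, of 1]) auto
  have le: "L2_inner M (\<lambda>x. F m x - f x) (\<lambda>x. F m x - f x) \<le> (1/4) ^ m" for m
    using fast L2_fast_Cauchy_AE_limit(2)[OF FL f lim, of 1 m] by auto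
  have "(\<lambda>n. L2_inner M (\<lambda>x. F n x - f x) (\<lambda>x. F n x - f x)) \<longlonglongrightarrow> 0"
    by (rule real_tendsto_sandwich[OF _ _ tendsto_const LIMSEQ_power_zero[of "1/4::real"]])
      (auto intro!: always_eventually le L2.nonneg L2.diff_closed FL fL)
  with closedin_L2_limit[OF K _ fL this] F
  show "\<exists>f\<in>K. (\<lambda>n. L2_inner M (\<lambda>x. F n x - f x) (\<lambda>x. F n x - f x)) \<longlonglongrightarrow> 0" by blast
qed

section \<open>Metric projection in $L^2$\<close>

lemma L2_inner_cong_AE:
  assumes "f \<in> L2 M" "g \<in> L2 M" "f' \<in> L2 M" "g' \<in> L2 M"
    and "AE x in M. f x = f' x" "AE x in M. g x = g' x"
  shows "L2_inner M f g = L2_inner M f' g'"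
  unfolding L2_inner_def
proof (rule integral_cong_AE)
  show "(\<lambda>x. f x * g x) \<in> borel_measurable M" "(\<lambda>x. f' x * g' x) \<in> borel_measurable M"
    using assms(1-4) by (auto intro: borel_measurable_integrable[OF integrable_L2_mult])
  show "AE x in M. f x * g x = f' x * g' x" using assms(5,6) by eventually_elim simp
qed

lemma zero_L2: "(\<lambda>_. 0) \<in> L2 M"
  by (simp add: L2_def)

lemma L2_inner_diff_self:
  assumes "f \<in> L2 M" "g \<in> L2 M"
  shows "L2_inner M (\<lambda>x. f x - g x) (\<lambda>x. f x - g x) = L2_inner M f f - 2 * L2_inner M f g + L2_inner M g g"
  using assms L2.sym[OF assms] by (simp add: L2.bilinear)

lemma L2_norm_diff_le_iff:
  assumes "f \<in> L2 M" "p \<in> L2 M" "q \<in> L2 M"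
  shows "L2_norm M (\<lambda>x. f x - p x) \<le> L2_norm M (\<lambda>x. f x - q x) \<longleftrightarrow>
    L2_inner M p p - 2 * L2_inner M f p \<le> L2_inner M q q - 2 * L2_inner M f q"
  using assms by (auto simp: L2_norm_eq_sqrt_inner L2_inner_diff_self)

lemma nearest_imp_variational_inequality:
  assumes K: "K \<subseteq> L2 M" "L2_convex_set K" and f: "f \<in> L2 M" and p: "p \<in> K" and q: "q \<in> K"
    and nearest: "\<forall>q\<in>K. L2_norm M (\<lambda>x. f x - p x) \<le> L2_norm M (\<lambda>x. f x - q x)"
  shows "L2_inner M (\<lambda>x. f x - p x) (\<lambda>x. q x - p x) \<le> 0"
proof -
  have L2: "p \<in> L2 M" "q \<in> L2 M" using K p q by auto
  have "L2_inner M f (\<lambda>x. q x - p x) \<le> L2_inner M p (\<lambda>x. q x - p x)"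
  proof (rule L2.minimizer_imp_variational_inequality[where L = "L2_inner M f", OF K p q])
    show "L2_inner M p p - 2 * L2_inner M f p \<le> L2_inner M w w - 2 * L2_inner M f w" if "w \<in> K" for w
      using nearest that K f p by (subst L2_norm_diff_le_iff[symmetric]) auto
  qed (simp_all add: L2.add_right L2.scale_right f)
  then show ?thesis using L2 f by (simp add: L2.diff_left L2.diff_closed)
qed

text \<open>
  Minimizing the distance to \<open>f\<close> is minimizing $\|p\|^2 - 2 \langle f, p \rangle$.  Existence is needed
  to know that the choice in \<open>L2_proj\<close> picks a nearest point at all.
\<close>

lemma L2_proj_nearest:
  assumes K: "closedin (L2_topology M) K" "L2_convex_set K" "K \<noteq> {}" and f: "f \<in> L2 M"
  shows "L2_proj M K f \<in> K \<and>
    (\<forall>q\<in>K. L2_norm M (\<lambda>x. f x - L2_proj M K f x) \<le> L2_norm M (\<lambda>x. f x - q x))"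
proof -
  have "\<exists>u\<in>K. \<forall>w\<in>K. L2_inner M u u - 2 * L2_inner M f u \<le> L2_inner M w w - 2 * L2_inner M f w"
  proof (rule L2.minimizer_exists[OF closedin_L2_subset[OF K(1)] K(2,3) closedin_L2_complete[OF K(1)]])
    show "(L2_inner M f g)\<^sup>2 \<le> L2_inner M f f * L2_inner M g g" if "g \<in> L2 M" for g
      using L2.Cauchy_Schwarz[OF f that] .
  qed (simp_all add: L2.add_right L2.scale_right f)
  then have "\<exists>p. p \<in> K \<and> (\<forall>q\<in>K. L2_norm M (\<lambda>x. f x - p x) \<le> L2_norm M (\<lambda>x. f x - q x))"
    using closedin_L2_subset[OF K(1)] f by (auto simp: L2_norm_diff_le_iff subset_eq)
  then show ?thesis unfolding L2_proj_def by (rule someI_ex)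
qed

text \<open>
  Any two points of \<open>K\<close> that satisfy the variational inequality agree almost everywhere: add the
  inequality of each, tested with the other point, to get $\|z - P\|^2 \le 0$.
\<close>

lemma AE_eq_L2_proj_iff:
  assumes K: "closedin (L2_topology M) K" "L2_convex_set K" and f: "f \<in> L2 M" and z: "z \<in> K"
  shows "(AE x in M. z x = L2_proj M K f x) \<longleftrightarrow>
    (\<forall>q\<in>K. L2_inner M (\<lambda>x. f x - z x) (\<lambda>x. q x - z x) \<le> 0)"
proof -
  define P where "P = L2_proj M K f"
  have K_L2: "g \<in> L2 M" if "g \<in> K" for g using that closedin_L2_subset[OF K(1)] by auto
  have P: "P \<in> K" and P_nearest: "\<forall>q\<in>K. L2_norm M (\<lambda>x. f x - P x) \<le> L2_norm M (\<lambda>x. f x - q x)"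
    using L2_proj_nearest[OF K _ f] z unfolding P_def by auto
  have P_le: "L2_inner M (\<lambda>x. f x - P x) (\<lambda>x. q x - P x) \<le> 0" if "q \<in> K" for q
    using nearest_imp_variational_inequality[OF closedin_L2_subset[OF K(1)] K(2) f P that P_nearest] .
  show ?thesis unfolding P_def[symmetric]
  proof
    assume eq: "AE x in M. z x = P x"
    show "\<forall>q\<in>K. L2_inner M (\<lambda>x. f x - z x) (\<lambda>x. q x - z x) \<le> 0"
    proof
      fix q assume q: "q \<in> K"
      have "L2_inner M (\<lambda>x. f x - z x) (\<lambda>x. q x - z x) = L2_inner M (\<lambda>x. f x - P x) (\<lambda>x. q x - P x)"
        using eq by (intro L2_inner_cong_AE L2.diff_closed f K_L2 z P q) (auto elim: eventually_mono)
      then show "L2_inner M (\<lambda>x. f x - z x) (\<lambda>x. q x - z x) \<le> 0" using P_le[OF q] by simp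
    qed
  next
    assume "\<forall>q\<in>K. L2_inner M (\<lambda>x. f x - z x) (\<lambda>x. q x - z x) \<le> 0"
    then have "L2_inner M (\<lambda>x. f x - z x) (\<lambda>x. P x - z x) \<le> 0" using P by blast
    moreover note P_le[OF z]
    moreover have "z \<in> L2 M" "P \<in> L2 M" using K_L2 z P by auto
    ultimately have "L2_inner M (\<lambda>x. z x - P x) (\<lambda>x. z x - P x) \<le> 0"
      using f L2.sym[of z M P] by (simp add: L2.bilinear)
    then have "L2_inner M (\<lambda>x. z x - P x) (\<lambda>x. z x - P x) = 0"
      using L2.nonneg[OF L2.diff_closed[OF K_L2[OF z] K_L2[OF P]]] by simp
    then show "AE x in M. z x = P x"
      by (simp add: L2_inner_self_eq_0_iff L2.diff_closed K_L2 z P)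
  qed
qed

lemma variational_inequality_iff:
  assumes "p \<in> L2 M" "z \<in> L2 M" "K \<subseteq> L2 M"
  shows "variational_inequality M K \<xi> p z \<longleftrightarrow>
    (\<forall>y\<in>K. 0 \<le> L2_inner M p (\<lambda>x. y x - z x) + \<xi> * L2_inner M z (\<lambda>x. y x - z x))"
proof -
  have "(LINT x|M. (p x + \<xi> * z x) * (y x - z x))
      = L2_inner M p (\<lambda>x. y x - z x) + \<xi> * L2_inner M z (\<lambda>x. y x - z x)" if "y \<in> K" for y
  proof -
    have "(LINT x|M. (p x + \<xi> * z x) * (y x - z x)) = L2_inner M (\<lambda>x. p x + \<xi> * z x) (\<lambda>x. y x - z x)"
      by (simp add: L2_inner_def)
    also have "\<dots> = L2_inner M p (\<lambda>x. y x - z x) + \<xi> * L2_inner M z (\<lambda>x. y x - z x)"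
      using assms that by (subst L2.add_left) (auto simp: L2.scale_left L2.diff_closed L2_scale)
    finally show ?thesis .
  qed
  then show ?thesis by (simp add: variational_inequality_def)
qed

text \<open>
  The variational inequality for $p + \xi z$ is that of the nearest point for \<open>f = - p / \<xi>\<close>, multiplied
  by \<open>- \<xi>\<close>.
\<close>

lemma optimality_iff_projection:
  assumes K: "closedin (L2_topology M) K" "L2_convex_set K" and zK: "z \<in> K" and p: "p \<in> L2 M"
    and \<xi>: "0 < \<xi>"
  shows "variational_inequality M K \<xi> p z \<longleftrightarrow> (AE x in M. z x = L2_proj M K (\<lambda>x. - p x / \<xi>) x)"
proof -
  have K_L2: "K \<subseteq> L2 M" by (rule closedin_L2_subset[OF K(1)])
  have z: "z \<in> L2 M" using zK K_L2 by auto
  have eq: "(\<lambda>x. - p x / \<xi>) = (\<lambda>x. (- 1 / \<xi>) * p x)" by auto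
  have f: "(\<lambda>x. - p x / \<xi>) \<in> L2 M" unfolding eq by (rule L2_scale[OF p])
  have "L2_inner M (\<lambda>x. - p x / \<xi> - z x) (\<lambda>x. y x - z x) \<le> 0 \<longleftrightarrow>
      0 \<le> L2_inner M p (\<lambda>x. y x - z x) + \<xi> * L2_inner M z (\<lambda>x. y x - z x)" if "y \<in> K" for y
  proof -
    have h: "(\<lambda>x. y x - z x) \<in> L2 M" using that K_L2 z by (auto intro: L2.diff_closed)
    have "L2_inner M (\<lambda>x. - p x / \<xi> - z x) (\<lambda>x. y x - z x)
        = (- 1 / \<xi>) * L2_inner M p (\<lambda>x. y x - z x) - L2_inner M z (\<lambda>x. y x - z x)"
      unfolding L2.diff_left[OF f z h] unfolding eq L2.scale_left[OF p h] ..
    also have "\<dots> = - (L2_inner M p (\<lambda>x. y x - z x) + \<xi> * L2_inner M z (\<lambda>x. y x - z x)) / \<xi>"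
      using \<xi> by (simp add: field_simps)
    also have "\<dots> \<le> 0 \<longleftrightarrow> 0 \<le> L2_inner M p (\<lambda>x. y x - z x) + \<xi> * L2_inner M z (\<lambda>x. y x - z x)"
      using \<xi> by (auto simp: divide_le_0_iff)
    finally show ?thesis .
  qed
  then show ?thesis
    unfolding AE_eq_L2_proj_iff[OF K f zK] variational_inequality_iff[OF p z K_L2] by blast
qed

section \<open>Directional derivatives of functionals on $L^2$\<close>

text \<open>
  The functional is defined on functions.  That it does not see null sets follows from
  differentiability at one of the two points, because an increment of norm zero changes its
  value by at most zero.
\<close>

lemma has_L2_gradient_cong_AE:
  assumes J: "has_L2_gradient M J g u" and L2: "u \<in> L2 M" "v \<in> L2 M" and eq: "AE x in M. v x = u x"
  shows "J v = J u"
proof -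
  define h where "h = (\<lambda>x. v x - u x)"
  have h: "h \<in> L2 M" "AE x in M. h x = 0"
    using L2 eq by (auto simp: h_def L2.diff_closed)
  have g: "g \<in> L2 M" using J by (simp add: has_L2_gradient_def)
  have "L2_norm M h = 0"
    using h by (simp add: L2_norm_eq_sqrt_inner L2_inner_self_eq_0_iff)
  moreover have "L2_inner M g h = L2_inner M g (\<lambda>_. 0)"
    using h g by (intro L2_inner_cong_AE zero_L2) auto
  then have "L2_inner M g h = 0" by (simp add: L2_inner_def)
  moreover obtain d where "d > 0" "\<forall>h\<in>L2 M. L2_norm M h < d \<longrightarrow>
      \<bar>J (\<lambda>x. u x + h x) - J u - L2_inner M g h\<bar> \<le> 1 * L2_norm M h"
    using J unfolding has_L2_gradient_def by (meson zero_less_one)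
  ultimately have "\<bar>J (\<lambda>x. u x + h x) - J u\<bar> \<le> 0" using h(1) by fastforce
  then show ?thesis by (simp add: h_def)
qed

lemma has_L2_gradient_directional_derivative:
  assumes J: "has_L2_gradient M J g u" and h: "h \<in> L2 M"
  shows "((\<lambda>t. (J (\<lambda>x. u x + t * h x) - J u) / t) \<longlongrightarrow> L2_inner M g h) (at_right 0)"
proof (rule tendstoI)
  fix e :: real assume e: "0 < e"
  have g: "g \<in> L2 M" using J by (simp add: has_L2_gradient_def)
  define n where "n = L2_norm M h"
  have n: "0 \<le> n" by (simp add: n_def L2_norm_nonneg)
  obtain d where d: "d > 0" "\<And>k. k \<in> L2 M \<Longrightarrow> L2_norm M k < d \<Longrightarrow>
      \<bar>J (\<lambda>x. u x + k x) - J u - L2_inner M g k\<bar> \<le> e / (n + 1) * L2_norm M k"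
    using J e n unfolding has_L2_gradient_def by (metis add_nonneg_pos divide_pos_pos zero_less_one)
  have "0 < d / (n + 1)" using d n by simp
  from eventually_at_right_real[OF this]
  show "\<forall>\<^sub>F t in at_right 0. dist ((J (\<lambda>x. u x + t * h x) - J u) / t) (L2_inner M g h) < e"
  proof eventually_elim
    case (elim t)
    then have t: "0 < t" "t * (n + 1) < d" using n by (auto simp: field_simps)
    have norm: "L2_norm M (\<lambda>x. t * h x) = t * n"
      using t h by (simp add: L2_norm_eq_sqrt_inner n_def L2.bilinear real_sqrt_mult)
    have "t * n < d" using t n by (simp add: ring_distribs)
    then have "\<bar>J (\<lambda>x. u x + t * h x) - J u - t * L2_inner M g h\<bar> \<le> e / (n + 1) * (t * n)"
      using d(2)[OF L2_scale[OF h, of t]] norm by (simp add: L2.scale_right[OF h g])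
    then have "\<bar>J (\<lambda>x. u x + t * h x) - J u - t * L2_inner M g h\<bar> / t \<le> e / (n + 1) * n"
      using t by (simp add: field_simps)
    also have "\<dots> < e" using e n by (simp add: field_simps)
    also have "\<bar>J (\<lambda>x. u x + t * h x) - J u - t * L2_inner M g h\<bar> / t
        = \<bar>(J (\<lambda>x. u x + t * h x) - J u - t * L2_inner M g h) / t\<bar>"
      using t by (simp add: abs_divide)
    also have "(J (\<lambda>x. u x + t * h x) - J u - t * L2_inner M g h) / t
        = (J (\<lambda>x. u x + t * h x) - J u) / t - L2_inner M g h"
      using t by (simp add: diff_divide_distrib)
    finally show ?case by (simp add: dist_real_def)
  qed
qed

text \<open>
  By convexity the difference quotients along \<open>h\<close> are at most $J(u + h) - J(u)$, hence so is their
  limit.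
\<close>

lemma convex_fun_ge_tangent:
  assumes J: "has_L2_gradient M J g u" and u: "u \<in> L2 M" and h: "h \<in> L2 M"
    and conv: "L2_convex_fun M J"
  shows "J u + L2_inner M g h \<le> J (\<lambda>x. u x + h x)"
proof -
  have "L2_inner M g h \<le> J (\<lambda>x. u x + h x) - J u"
  proof (rule tendsto_upperbound[OF has_L2_gradient_directional_derivative[OF J h]])
    show "\<forall>\<^sub>F t in at_right 0. (J (\<lambda>x. u x + t * h x) - J u) / t \<le> J (\<lambda>x. u x + h x) - J u"
      using eventually_at_right_real[OF zero_less_one]
    proof eventually_elim
      case (elim t)
      have "J (\<lambda>x. (1 - t) * u x + t * (u x + h x)) \<le> (1 - t) * J u + t * J (\<lambda>x. u x + h x)"
        using conv[unfolded L2_convex_fun_def, rule_format, OF u L2_add[OF u h], of t] elim by simp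
      moreover have "(\<lambda>x. (1 - t) * u x + t * (u x + h x)) = (\<lambda>x. u x + t * h x)"
        by (auto simp: algebra_simps)
      ultimately show ?case using elim by (simp add: field_simps)
    qed
  qed simp
  then show ?thesis by simp
qed

section \<open>Products of Lebesgue measure\<close>

lemma sigma_finite_completion:
  assumes "sigma_finite_measure M"
  shows "sigma_finite_measure (completion M)"
proof -
  interpret sigma_finite_measure M by fact
  obtain A where "countable A" "A \<subseteq> sets M" "\<Union>A = space M" "\<forall>a\<in>A. emeasure M a \<noteq> \<infinity>"
    using sigma_finite_countable by blast
  then show ?thesis
    by (intro sigma_finite_measure.intro exI[of _ A])
      (auto simp: subset_eq intro!: sets_completionI_sets)
qed

interpretation lebesgue: sigma_finite_measure "lebesgue :: 'a::euclidean_space measure"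
  by (rule sigma_finite_completion[OF sigma_finite_lborel])

lemma nn_integral_pair_mult:
  assumes "sigma_finite_measure N" and [measurable]: "f \<in> borel_measurable M" "g \<in> borel_measurable N"
  shows "(\<integral>\<^sup>+z. f (fst z) * g (snd z) \<partial>(M \<Otimes>\<^sub>M N)) = (\<integral>\<^sup>+x. f x \<partial>M) * (\<integral>\<^sup>+y. g y \<partial>N)"
proof -
  interpret sigma_finite_measure N by fact
  have "(\<integral>\<^sup>+z. f (fst z) * g (snd z) \<partial>(M \<Otimes>\<^sub>M N)) = (\<integral>\<^sup>+x. \<integral>\<^sup>+y. f x * g y \<partial>N \<partial>M)"
    by (subst nn_integral_fst[symmetric]) auto
  then show ?thesis
    by (simp add: nn_integral_cmult nn_integral_multc)
qed

text \<open>
  If \<open>N\<close> is null, then so are \<open>N \<times> X\<close> and \<open>X \<times> N\<close>, with \<open>X\<close> the whole space.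
\<close>

lemma AE_pair_fst_snd:
  assumes "sigma_finite_measure M" and P: "AE x in M. P x"
  shows "AE z in M \<Otimes>\<^sub>M M. P (fst z) \<and> P (snd z)"
proof -
  interpret sigma_finite_measure M by fact
  obtain N where N: "N \<in> null_sets M" "{x \<in> space M. \<not> P x} \<subseteq> N"
    using P by (auto elim!: AE_E simp: null_sets_def)
  have "N \<times> space M \<union> space M \<times> N \<in> null_sets (M \<Otimes>\<^sub>M M)"
    using N by (intro null_sets.Un times_in_null_sets1 times_in_null_sets2) auto
  then show ?thesis
    by (rule AE_I') (use N in \<open>auto simp: space_pair_measure\<close>)
qed

lemma borel_measurable_lebesgue_ident: "(\<lambda>x::'a::euclidean_space. x) \<in> lebesgue \<rightarrow>\<^sub>M borel"
  by (intro measurable_completion) simp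

section \<open>The energy form of the Robin problem\<close>

text \<open>
  A linear square root of the Gagliardo integrand: the integrand of \<open>u\<close> and \<open>v\<close> is the product of
  their difference quotients.  The nonlocal part of the energy thus becomes the inner product of an
  $L^2$ space, to which the results above apply.
\<close>

definition difference_quotient :: "real \<Rightarrow> ('a::euclidean_space \<Rightarrow> real) \<Rightarrow> 'a \<times> 'a \<Rightarrow> real" where
  "difference_quotient s u =
     (\<lambda>(x, y). (u x - u y) / sqrt (norm (x - y) powr (real DIM('a) + 2 * s)))"

definition interaction_measure :: "'a::euclidean_space set \<Rightarrow> ('a \<times> 'a) measure" where
  "interaction_measure \<Omega> = restrict_space (lebesgue \<Otimes>\<^sub>M lebesgue) (interaction_region \<Omega>)"

lemma difference_quotient_add:
  "difference_quotient s (\<lambda>x. u x + v x) = (\<lambda>z. difference_quotient s u z + difference_quotient s v z)"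
  by (auto simp: difference_quotient_def add_divide_distrib[symmetric])

lemma difference_quotient_scale:
  "difference_quotient s (\<lambda>x. c * u x) = (\<lambda>z. c * difference_quotient s u z)"
  by (auto simp: difference_quotient_def right_diff_distrib)

lemma difference_quotient_diff:
  "difference_quotient s (\<lambda>x. u x - v x) = (\<lambda>z. difference_quotient s u z - difference_quotient s v z)"
  by (auto simp: difference_quotient_def diff_divide_distrib[symmetric])

lemma gagliardo_integrand_eq:
  "gagliardo_integrand s u v = (\<lambda>z. difference_quotient s u z * difference_quotient s v z)"
  by (auto simp: gagliardo_integrand_def difference_quotient_def)

lemma borel_measurable_difference_quotient:
  assumes u: "u \<in> borel_measurable (lebesgue :: 'a::euclidean_space measure)"
  shows "difference_quotient s u \<in> borel_measurable (lebesgue \<Otimes>\<^sub>M lebesgue)"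
proof -
  note [measurable] = u measurable_compose[OF measurable_fst borel_measurable_lebesgue_ident]
    measurable_compose[OF measurable_snd borel_measurable_lebesgue_ident]
  show ?thesis unfolding difference_quotient_def case_prod_beta by measurable
qed

lemma sets_interaction_region:
  assumes "\<Omega> \<in> sets (lebesgue :: 'a::euclidean_space measure)"
  shows "interaction_region \<Omega> \<in> sets (lebesgue \<Otimes>\<^sub>M lebesgue)"
proof -
  have "- \<Omega> \<in> sets lebesgue" using assms by (simp add: Compl_in_sets_lebesgue)
  then show ?thesis using assms unfolding interaction_region_def by auto
qed

lemma robin_space_iff:
  assumes \<Omega>: "\<Omega> \<in> sets (lebesgue :: 'a::euclidean_space measure)"
  shows "u \<in> robin_space s \<Omega> \<kappa> \<longleftrightarrow> u \<in> borel_measurable lebesgue \<and> u \<in> L2 (lebesgue_on \<Omega>) \<and>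
     u \<in> L2 (robin_measure \<Omega> \<kappa>) \<and> difference_quotient s u \<in> L2 (interaction_measure \<Omega>)"
proof -
  have "difference_quotient s u \<in> borel_measurable (interaction_measure \<Omega>)"
    if "u \<in> borel_measurable lebesgue"
    unfolding interaction_measure_def
    by (intro measurable_restrict_space1 borel_measurable_difference_quotient that)
  then have "difference_quotient s u \<in> L2 (interaction_measure \<Omega>) \<longleftrightarrow>
      set_integrable (lebesgue \<Otimes>\<^sub>M lebesgue) (interaction_region \<Omega>) (gagliardo_integrand s u u)"
    if "u \<in> borel_measurable lebesgue"
    using that sets_interaction_region[OF \<Omega>] unfolding L2_def
    by (simp add: interaction_measure_def integrable_restrict_space set_integrable_def
        gagliardo_integrand_eq power2_eq_square space_pair_measure)
  then show ?thesis unfolding robin_space_def by blast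
qed

definition robin_form ::
    "real \<Rightarrow> 'a::euclidean_space set \<Rightarrow> ('a \<Rightarrow> real) \<Rightarrow> ('a \<Rightarrow> real) \<Rightarrow> ('a \<Rightarrow> real) \<Rightarrow> real" where
  "robin_form s \<Omega> \<kappa> u v = frac_const DIM('a) s / 2 *
     L2_inner (interaction_measure \<Omega>) (difference_quotient s u) (difference_quotient s v)
     + L2_inner (robin_measure \<Omega> \<kappa>) u v"

lemma robin_weak_solution_iff:
  assumes \<Omega>: "\<Omega> \<in> sets (lebesgue :: 'a::euclidean_space measure)"
  shows "robin_weak_solution s \<Omega> \<kappa> w z u \<longleftrightarrow> u \<in> robin_space s \<Omega> \<kappa> \<and>
     (\<forall>v\<in>robin_space s \<Omega> \<kappa>. robin_form s \<Omega> \<kappa> u v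
        = L2_inner (lebesgue_on \<Omega>) w v + L2_inner (robin_measure \<Omega> \<kappa>) z v)"
  using sets_interaction_region[OF \<Omega>]
  by (simp add: robin_weak_solution_def robin_form_def L2_inner_def interaction_measure_def
      integral_restrict_space gagliardo_integrand_eq set_lebesgue_integral_def space_pair_measure)

lemma frac_const_pos:
  assumes "0 < s" "s < 1"
  shows "0 < frac_const N s"
proof -
  have "0 < Gamma ((2 * s + real N) / 2)" "0 < Gamma (1 - s)"
    using assms by (auto intro!: Gamma_real_pos)
  then show ?thesis using assms by (simp add: frac_const_def)
qed

locale robin_setting =
  fixes s :: real and \<Omega> :: "'a::euclidean_space set" and \<kappa> :: "'a \<Rightarrow> real"
  assumes s: "0 < s" "s < 1"
    and \<Omega>: "\<Omega> \<in> sets lebesgue" "bounded \<Omega>"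
    and \<kappa>_measurable: "\<kappa> \<in> borel_measurable (lebesgue_on (- \<Omega>))"
    and \<kappa>_pos: "AE x in lebesgue_on (- \<Omega>). 0 < \<kappa> x"
begin

abbreviation "\<mu> \<equiv> robin_measure \<Omega> \<kappa>"
abbreviation "W \<equiv> robin_space s \<Omega> \<kappa>"
abbreviation "\<E> \<equiv> robin_form s \<Omega> \<kappa>"
abbreviation "\<I> \<equiv> interaction_measure \<Omega>"

lemma compl_\<Omega>: "- \<Omega> \<in> sets lebesgue"
  using \<Omega>(1) by (simp add: Compl_in_sets_lebesgue)

lemma W_D:
  assumes "u \<in> W"
  shows "u \<in> borel_measurable lebesgue" "u \<in> L2 (lebesgue_on \<Omega>)" "u \<in> L2 \<mu>"
    "difference_quotient s u \<in> L2 \<I>"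
  using assms by (auto simp: robin_space_iff[OF \<Omega>(1)])

sublocale energy: semi_inner_product_space W \<E>
proof
  fix f g h :: "'a \<Rightarrow> real" and c :: real
  assume f: "f \<in> W"
  show "(\<lambda>x. c * f x) \<in> W"
    using W_D[OF f] by (auto simp: robin_space_iff[OF \<Omega>(1)] difference_quotient_scale L2_scale)
  show "0 \<le> \<E> f f"
    using W_D[OF f] frac_const_pos[OF s, of "DIM('a)"] by (simp add: robin_form_def L2.nonneg)
  {
    assume g: "g \<in> W"
    show "(\<lambda>x. f x + g x) \<in> W"
      using W_D[OF f] W_D[OF g]
      by (auto simp: robin_space_iff[OF \<Omega>(1)] difference_quotient_add L2_add)
    show "\<E> f g = \<E> g f"
      by (simp add: robin_form_def L2_inner_def mult.commute)
    assume h: "h \<in> W"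
    show "\<E> (\<lambda>x. f x + g x) h = \<E> f h + \<E> g h"
      using W_D[OF f] W_D[OF g] W_D[OF h]
      by (simp add: robin_form_def difference_quotient_add L2.add_left ring_distribs)
  }
  assume h: "h \<in> W"
  show "\<E> (\<lambda>x. c * f x) h = c * \<E> f h"
    using W_D[OF f] W_D[OF h]
    by (simp add: robin_form_def difference_quotient_scale L2.scale_left ring_distribs)
qed

text \<open>
  A positive weight does not change null sets, so \<open>\<mu>\<close> sees exactly the Lebesgue null sets outside
  \<open>\<Omega>\<close>.
\<close>

lemma AE_lebesgue_iff:
  "(AE x in lebesgue. P x) \<longleftrightarrow> (AE x in lebesgue_on \<Omega>. P x) \<and> (AE x in \<mu>. P x)"
proof -
  have 1: "(AE x in lebesgue_on \<Omega>. P x) \<longleftrightarrow> (AE x in lebesgue. x \<in> \<Omega> \<longrightarrow> P x)"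
    using \<Omega> by (simp add: AE_restrict_space_iff)
  have "(AE x in \<mu>. P x) \<longleftrightarrow> (AE x in lebesgue_on (- \<Omega>). 0 < ennreal (\<kappa> x) \<longrightarrow> P x)"
    unfolding robin_measure_def using \<kappa>_measurable by (intro AE_density) measurable
  also have "\<dots> \<longleftrightarrow> (AE x in lebesgue_on (- \<Omega>). P x)"
    using \<kappa>_pos by (intro eventually_subst) (auto elim!: eventually_mono)
  also have "\<dots> \<longleftrightarrow> (AE x in lebesgue. x \<in> - \<Omega> \<longrightarrow> P x)"
    using compl_\<Omega> by (simp add: AE_restrict_space_iff)
  finally have 2: "(AE x in \<mu>. P x) \<longleftrightarrow> (AE x in lebesgue. x \<in> - \<Omega> \<longrightarrow> P x)" .
  show ?thesis unfolding 1 2 AE_conj_iff[symmetric] by (rule AE_cong) auto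
qed

section \<open>Control of the interior by the energy\<close>

text \<open>
  The sets on which \<open>\<kappa> \<ge> 1 / (n + 1)\<close> and the norm is at most \<open>n\<close> exhaust almost all of the
  complement of \<open>\<Omega>\<close>.  That complement has infinite measure because \<open>\<Omega>\<close> is bounded, so one
  of these sets has positive measure.
\<close>

lemma exterior_set_with_weight_bounded_below:
  obtains A \<delta> R where "A \<in> sets lebesgue" "A \<subseteq> - \<Omega>" "emeasure lebesgue A \<noteq> 0" "0 < \<delta>"
    "\<And>x. x \<in> A \<Longrightarrow> \<delta> \<le> \<kappa> x" "0 < R" "A \<subseteq> cball 0 R" "\<Omega> \<subseteq> cball 0 R"
proof -
  define A where "A n = {x \<in> - \<Omega>. 1 / real (Suc n) \<le> \<kappa> x} \<inter> cball 0 (real n)" for n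
  have A: "A n \<in> sets lebesgue" for n
  proof -
    have "{x \<in> space (lebesgue_on (- \<Omega>)). 1 / real (Suc n) \<le> \<kappa> x} \<in> sets (lebesgue_on (- \<Omega>))"
      using \<kappa>_measurable by measurable
    then have "{x \<in> - \<Omega>. 1 / real (Suc n) \<le> \<kappa> x} \<in> sets lebesgue"
      using compl_\<Omega> by (auto simp: sets_restrict_space_iff space_restrict_space)
    then show ?thesis unfolding A_def by auto
  qed
  have "\<exists>n. emeasure lebesgue (A n) \<noteq> 0"
  proof (rule ccontr)
    assume "\<not> ?thesis"
    then have "(\<Union>n. A n) \<in> null_sets lebesgue" using A by (intro null_sets_UN) auto
    then have "AE x in lebesgue. x \<notin> (\<Union>n. A n)" by (rule AE_not_in)
    moreover have "AE x in lebesgue. x \<in> - \<Omega> \<longrightarrow> 0 < \<kappa> x"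
      using \<kappa>_pos compl_\<Omega> by (simp add: AE_restrict_space_iff)
    ultimately have "AE x in lebesgue. x \<in> UNIV \<longleftrightarrow> x \<in> \<Omega>"
    proof eventually_elim
      case (elim x)
      show ?case
      proof (rule ccontr)
        assume "\<not> ?thesis"
        then have x: "x \<in> - \<Omega>" "0 < \<kappa> x" using elim by auto
        obtain m where m: "1 / real (Suc m) < \<kappa> x" using reals_Archimedean[OF x(2)] by (auto simp: inverse_eq_divide)
        obtain k where k: "norm x \<le> real k" using real_arch_simple by blast
        have "1 / real (Suc (max m k)) \<le> 1 / real (Suc m)" by (intro divide_left_mono) auto
        then have "x \<in> A (max m k)" using x m k by (auto simp: A_def)
        with elim show False by blast
      qed
    qed
    then have "emeasure lebesgue (UNIV :: 'a set) = emeasure lebesgue \<Omega>"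
      using \<Omega>(1) by (intro emeasure_eq_AE) auto
    moreover have "emeasure lebesgue \<Omega> < \<infinity>" using bounded_set_imp_lmeasurable[OF \<Omega>(2,1)]
      by (auto simp: fmeasurable_def simp del: emeasure_completion)
    ultimately show False by simp
  qed
  then obtain n where n: "emeasure lebesgue (A n) \<noteq> 0" by blast
  obtain r where r: "\<Omega> \<subseteq> cball 0 r"
    using \<Omega>(2) bounded_subset_ballD[of \<Omega> 0] ball_subset_cball by blast
  show ?thesis
    by (rule that[of "A n" "1 / real (Suc n)" "max 1 (max r (real n))"])
      (use A n r in \<open>auto simp: A_def\<close>)
qed

text \<open>
  A Poincare inequality for the Robin energy.  Integrate
  $u(x)^2 \le 2 (u(x) - u(y))^2 + 2 u(y)^2$ over \<open>\<Omega> \<times> A\<close>, where \<open>A\<close> is a bounded set outside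
  \<open>\<Omega>\<close> with \<open>\<kappa> \<ge> \<delta>\<close>.  On that product $|x - y|^{N+2s} \le (2R)^{N+2s}$, so the three
  integrals are $|A| \|u\|_{L^2(\Omega)}^2$, at most $2 (2R)^{N+2s}$ times the Gagliardo integral, and at most
  $2 |\Omega| / \delta$ times $\|u\|_{L^2(\mu)}^2$.
\<close>

lemma energy_controls_L2:
  obtains C where "0 \<le> C" "\<And>u. u \<in> W \<Longrightarrow> L2_inner (lebesgue_on \<Omega>) u u \<le> C * \<E> u u"
proof -
  obtain A \<delta> R where A: "A \<in> sets lebesgue" "A \<subseteq> - \<Omega>" "emeasure lebesgue A \<noteq> 0"
    and \<delta>: "0 < \<delta>" "\<And>x. x \<in> A \<Longrightarrow> \<delta> \<le> \<kappa> x"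
    and R: "0 < R" "A \<subseteq> cball 0 R" "\<Omega> \<subseteq> cball 0 R"
    by (rule exterior_set_with_weight_bounded_below) blast
  define a where "a = measure lebesgue A"
  define b where "b = measure lebesgue \<Omega>"
  have "A \<in> lmeasurable" using A R bounded_subset[OF bounded_cball] by (intro bounded_set_imp_lmeasurable) auto
  then have ea: "emeasure lebesgue A = ennreal a"
    unfolding a_def by (intro emeasure_eq_ennreal_measure fmeasurableD2)
  have "\<Omega> \<in> lmeasurable" using \<Omega> by (intro bounded_set_imp_lmeasurable)
  then have eb: "emeasure lebesgue \<Omega> = ennreal b"
    unfolding b_def by (intro emeasure_eq_ennreal_measure fmeasurableD2)
  have a: "0 < a" using ea A(3) by (metis ennreal_neg linorder_not_less)
  have b: "0 \<le> b" by (simp add: b_def)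
  define p where "p = real DIM('a) + 2 * s"
  have p: "0 < p" using s by (simp add: p_def add_nonneg_pos)
  define D where "D = (2 * R) powr p"
  have D: "0 \<le> D" by (simp add: D_def)
  define c where "c = frac_const DIM('a) s / 2"
  have c: "0 < c" using frac_const_pos[OF s] by (simp add: c_def)
  define C where "C = 2 * D / (a * c) + 2 * b / (\<delta> * a)"
  have "L2_inner (lebesgue_on \<Omega>) u u \<le> C * \<E> u u" if u: "u \<in> W" for u
  proof -
    let ?q = "difference_quotient s u"
    define U where "U = L2_inner (lebesgue_on \<Omega>) u u"
    define G where "G = L2_inner \<I> ?q ?q"
    define K where "K = L2_inner \<mu> u u"
    have nonneg: "0 \<le> U" "0 \<le> G" "0 \<le> K"
      using W_D[OF u] by (auto simp: U_def G_def K_def L2.nonneg)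
    note [measurable] = A(1) \<Omega>(1) compl_\<Omega> W_D(1)[OF u] borel_measurable_difference_quotient[OF W_D(1)[OF u]]
      sets_interaction_region[OF \<Omega>(1)]
    have inside: "(\<integral>\<^sup>+z. (indicator \<Omega> (fst z) * ennreal ((u (fst z))\<^sup>2)) * indicator A (snd z)
        \<partial>(lebesgue \<Otimes>\<^sub>M lebesgue)) = ennreal (U * a)"
    proof -
      have "(\<integral>\<^sup>+x. indicator \<Omega> x * ennreal ((u x)\<^sup>2) \<partial>lebesgue) = ennreal U"
        using nn_integral_square_L2[OF W_D(2)[OF u]] \<Omega>(1)
        by (simp add: nn_integral_restrict_space U_def mult.commute)
      then show ?thesis
        using nonneg ea A(1) less_imp_le[OF a]
        by (subst nn_integral_pair_mult[OF lebesgue.sigma_finite_measure_axioms])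
          (auto simp: ennreal_mult simp del: emeasure_completion)
    qed
    have outside: "(\<integral>\<^sup>+z. indicator \<Omega> (fst z) * (indicator A (snd z) * ennreal ((u (snd z))\<^sup>2))
        \<partial>(lebesgue \<Otimes>\<^sub>M lebesgue)) \<le> ennreal (b * (K / \<delta>))"
    proof -
      have "(\<integral>\<^sup>+x. indicator A x * ennreal ((u x)\<^sup>2) \<partial>lebesgue)
          \<le> (\<integral>\<^sup>+x. ennreal (1 / \<delta>) * (ennreal (\<kappa> x) * ennreal ((u x)\<^sup>2) * indicator (- \<Omega>) x) \<partial>lebesgue)"
      proof (intro nn_integral_mono)
        fix x
        have "(u x)\<^sup>2 \<le> 1 / \<delta> * (\<kappa> x * (u x)\<^sup>2)" if "x \<in> A"
          using \<delta>(2)[OF that] \<delta>(1) by (simp add: field_simps mult_right_mono)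
        then have "ennreal ((u x)\<^sup>2) \<le> ennreal (1 / \<delta>) * (ennreal (\<kappa> x) * ennreal ((u x)\<^sup>2))" if "x \<in> A"
          using that \<delta>(2)[OF that] \<delta>(1) by (simp flip: ennreal_mult)
        then show "indicator A x * ennreal ((u x)\<^sup>2)
            \<le> ennreal (1 / \<delta>) * (ennreal (\<kappa> x) * ennreal ((u x)\<^sup>2) * indicator (- \<Omega>) x)"
          using A(2) by (auto simp: indicator_def)
      qed
      also have "\<dots> = ennreal (1 / \<delta>) * (\<integral>\<^sup>+x. ennreal (\<kappa> x) * ennreal ((u x)\<^sup>2) * indicator (- \<Omega>) x \<partial>lebesgue)"
      proof (rule nn_integral_cmult)
        have "(\<lambda>x. ennreal (\<kappa> x) * ennreal ((u x)\<^sup>2)) \<in> borel_measurable (lebesgue_on (- \<Omega>))"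
          using \<kappa>_measurable measurable_restrict_space1[OF W_D(1)[OF u], of "- \<Omega>"] by measurable
        then show "(\<lambda>x. ennreal (\<kappa> x) * ennreal ((u x)\<^sup>2) * indicator (- \<Omega>) x) \<in> borel_measurable lebesgue"
          using compl_\<Omega> by (subst (asm) borel_measurable_restrict_space_iff_ennreal) auto
      qed
      also have "(\<integral>\<^sup>+x. ennreal (\<kappa> x) * ennreal ((u x)\<^sup>2) * indicator (- \<Omega>) x \<partial>lebesgue)
          = (\<integral>\<^sup>+x. ennreal ((u x)\<^sup>2) \<partial>\<mu>)"
        unfolding robin_measure_def
        using compl_\<Omega> \<kappa>_measurable measurable_restrict_space1[OF W_D(1)[OF u], of "- \<Omega>"]
        by (subst nn_integral_density) (auto simp: nn_integral_restrict_space)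
      also have "\<dots> = ennreal K"
        by (simp add: nn_integral_square_L2[OF W_D(3)[OF u]] K_def)
      also have "ennreal (1 / \<delta>) * ennreal K = ennreal (K / \<delta>)"
        using nonneg \<delta>(1) by (simp flip: ennreal_mult)
      finally have X: "(\<integral>\<^sup>+x. indicator A x * ennreal ((u x)\<^sup>2) \<partial>lebesgue) \<le> ennreal (K / \<delta>)" .
      have "(\<integral>\<^sup>+z. indicator \<Omega> (fst z) * (indicator A (snd z) * ennreal ((u (snd z))\<^sup>2))
          \<partial>(lebesgue \<Otimes>\<^sub>M lebesgue)) = ennreal b * (\<integral>\<^sup>+x. indicator A x * ennreal ((u x)\<^sup>2) \<partial>lebesgue)"
        using eb \<Omega>(1) by (subst nn_integral_pair_mult[OF lebesgue.sigma_finite_measure_axioms])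
          (auto simp del: emeasure_completion)
      also have "\<dots> \<le> ennreal b * ennreal (K / \<delta>)" by (intro mult_left_mono X) auto
      also have "\<dots> = ennreal (b * (K / \<delta>))"
        using b nonneg \<delta>(1) by (subst ennreal_mult[symmetric]) auto
      finally show ?thesis .
    qed
    have across: "(\<integral>\<^sup>+z. indicator (\<Omega> \<times> A) z * ennreal ((?q z)\<^sup>2) \<partial>(lebesgue \<Otimes>\<^sub>M lebesgue)) \<le> ennreal G"
    proof -
      have "(\<integral>\<^sup>+z. indicator (\<Omega> \<times> A) z * ennreal ((?q z)\<^sup>2) \<partial>(lebesgue \<Otimes>\<^sub>M lebesgue))
          \<le> (\<integral>\<^sup>+z. ennreal ((?q z)\<^sup>2) * indicator (interaction_region \<Omega>) z \<partial>(lebesgue \<Otimes>\<^sub>M lebesgue))"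
        using A(2) by (intro nn_integral_mono) (auto simp: indicator_def interaction_region_def)
      also have "\<dots> = (\<integral>\<^sup>+z. ennreal ((?q z)\<^sup>2) \<partial>\<I>)"
        unfolding interaction_measure_def using sets_interaction_region[OF \<Omega>(1)]
        by (simp add: nn_integral_restrict_space space_pair_measure)
      finally show ?thesis by (simp add: nn_integral_square_L2[OF W_D(4)[OF u]] G_def)
    qed
    have pointwise: "(indicator \<Omega> (fst z) * ennreal ((u (fst z))\<^sup>2)) * indicator A (snd z)
        \<le> ennreal (2 * D) * (indicator (\<Omega> \<times> A) z * ennreal ((?q z)\<^sup>2))
          + ennreal 2 * (indicator \<Omega> (fst z) * (indicator A (snd z) * ennreal ((u (snd z))\<^sup>2)))" for z
    proof (cases "fst z \<in> \<Omega> \<and> snd z \<in> A")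
      case False
      then show ?thesis by (auto simp: indicator_def)
    next
      case True
      obtain x y where z: "z = (x, y)" by fastforce
      with True have xy: "x \<in> \<Omega>" "y \<in> A" by auto
      define t where "t = norm (x - y) powr p"
      have "x \<noteq> y" using xy A(2) by auto
      then have t: "0 < t" by (simp add: t_def)
      have "norm (x - y) \<le> norm x + norm y" by (rule norm_triangle_ineq4)
      also have "\<dots> \<le> 2 * R" using xy R(2,3) by fastforce
      finally have "t \<le> D" unfolding t_def D_def using p by (intro powr_mono2) auto
      have q: "(?q z)\<^sup>2 = (u x - u y)\<^sup>2 / t"
        using t by (simp add: difference_quotient_def z power_divide t_def p_def)
      \<comment> \<open>The difference of the two sides is the square of \<open>u x - 2 * u y\<close>.\<close>
      have "(u x)\<^sup>2 \<le> 2 * (u x - u y)\<^sup>2 + 2 * (u y)\<^sup>2"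
        using zero_le_power2[of "u x - 2 * u y"] by (simp add: power2_eq_square algebra_simps)
      also have "(u x - u y)\<^sup>2 = t * (?q z)\<^sup>2" using t q by simp
      also have "\<dots> \<le> D * (?q z)\<^sup>2" using \<open>t \<le> D\<close> by (intro mult_right_mono) auto
      finally have "(u x)\<^sup>2 \<le> 2 * D * (?q z)\<^sup>2 + 2 * (u y)\<^sup>2" by simp
      then have "ennreal ((u x)\<^sup>2) \<le> ennreal (2 * D * (?q z)\<^sup>2 + 2 * (u y)\<^sup>2)" by (rule ennreal_leI)
      also have "\<dots> = ennreal (2 * D) * ennreal ((?q z)\<^sup>2) + ennreal 2 * ennreal ((u y)\<^sup>2)"
        using D by (subst ennreal_plus) (auto simp: ennreal_mult)
      finally show ?thesis using xy by (simp add: z)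
    qed
    have "ennreal (U * a) \<le> (\<integral>\<^sup>+z. ennreal (2 * D) * (indicator (\<Omega> \<times> A) z * ennreal ((?q z)\<^sup>2))
          + ennreal 2 * (indicator \<Omega> (fst z) * (indicator A (snd z) * ennreal ((u (snd z))\<^sup>2)))
          \<partial>(lebesgue \<Otimes>\<^sub>M lebesgue))"
      unfolding inside[symmetric] by (intro nn_integral_mono pointwise)
    also have "\<dots> = ennreal (2 * D) * (\<integral>\<^sup>+z. indicator (\<Omega> \<times> A) z * ennreal ((?q z)\<^sup>2) \<partial>(lebesgue \<Otimes>\<^sub>M lebesgue))
        + ennreal 2 * (\<integral>\<^sup>+z. indicator \<Omega> (fst z) * (indicator A (snd z) * ennreal ((u (snd z))\<^sup>2))
          \<partial>(lebesgue \<Otimes>\<^sub>M lebesgue))"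
      by (subst nn_integral_add) (auto simp: nn_integral_cmult)
    also have "\<dots> \<le> ennreal (2 * D) * ennreal G + ennreal 2 * ennreal (b * (K / \<delta>))"
      by (intro add_mono mult_left_mono across outside) auto
    also have "\<dots> = ennreal (2 * D * G) + ennreal (2 * (b * (K / \<delta>)))"
      using D nonneg b \<delta>(1)
      by (intro arg_cong2[where f = "(+)"] ennreal_mult[symmetric]) auto
    also have "\<dots> = ennreal (2 * D * G + 2 * (b * (K / \<delta>)))"
      using D nonneg b \<delta>(1) by (intro ennreal_plus[symmetric]) auto
    finally have "U * a \<le> 2 * D * G + 2 * (b * (K / \<delta>))"
      using D nonneg b \<delta>(1) by (subst (asm) ennreal_le_iff) auto
    then have "U \<le> 2 * D / (a * c) * (c * G) + 2 * b / (\<delta> * a) * K"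
      using a c \<delta>(1) by (simp add: field_simps)
    also have "\<dots> \<le> C * (c * G) + C * K"
      using a b c D \<delta>(1) nonneg by (intro add_mono mult_right_mono) (auto simp: C_def)
    finally show ?thesis
      by (simp add: robin_form_def U_def G_def K_def c_def ring_distribs)
  qed
  moreover have "0 \<le> C" using a b c D \<delta>(1) by (simp add: C_def)
  ultimately show ?thesis using that by blast
qed

lemma AE_eq_0_if_energy_0:
  assumes u: "u \<in> W" and "\<E> u u = 0"
  shows "AE x in lebesgue. u x = 0"
proof -
  obtain C where C: "0 \<le> C" "\<And>u. u \<in> W \<Longrightarrow> L2_inner (lebesgue_on \<Omega>) u u \<le> C * \<E> u u"
    by (rule energy_controls_L2) blast
  have "L2_inner (lebesgue_on \<Omega>) u u = 0"
    using C(2)[OF u] assms(2) L2.nonneg[OF W_D(2)[OF u]] by simp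
  moreover have "L2_inner \<mu> u u = 0"
    using assms(2) L2.nonneg[OF W_D(3)[OF u]] L2.nonneg[OF W_D(4)[OF u]]
      frac_const_pos[OF s, of "DIM('a)"]
    by (simp add: robin_form_def add_nonneg_eq_0_iff)
  ultimately show ?thesis
    by (simp add: AE_lebesgue_iff L2_inner_self_eq_0_iff W_D(2,3)[OF u])
qed

section \<open>Weak solutions\<close>

text \<open>
  An energy Cauchy sequence is Cauchy in $L^2(\mu)$ and, by the Poincare inequality, in
  $L^2(\Omega)$; hence it converges almost everywhere.  The difference quotients then converge
  almost everywhere on the product, and Fatou's lemma gives convergence of each part of the energy.
\<close>

lemma robin_space_complete: "energy.complete_subset W"
  unfolding energy.complete_subset_def
proof (intro allI impI, elim conjE)
  fix F
  assume "\<forall>n. F n \<in> W"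
    and "\<forall>m n. m \<le> n \<longrightarrow> \<E> (\<lambda>x. F n x - F m x) (\<lambda>x. F n x - F m x) \<le> (1/4) ^ m"
  then have F: "F n \<in> W"
    and fast: "m \<le> n \<Longrightarrow> \<E> (\<lambda>x. F n x - F m x) (\<lambda>x. F n x - F m x) \<le> (1/4) ^ m" for m n
    by auto
  obtain C where C: "0 \<le> C" "\<And>u. u \<in> W \<Longrightarrow> L2_inner (lebesgue_on \<Omega>) u u \<le> C * \<E> u u"
    by (rule energy_controls_L2) blast
  define c where "c = frac_const DIM('a) s / 2"
  have c: "0 < c" using frac_const_pos[OF s] by (simp add: c_def)
  have parts: "c * L2_inner \<I> (difference_quotient s u) (difference_quotient s u) \<le> \<E> u u"
    "L2_inner \<mu> u u \<le> \<E> u u" if "u \<in> W" for u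
    using L2.nonneg[OF W_D(3)[OF that]] L2.nonneg[OF W_D(4)[OF that]] c
    by (auto simp: robin_form_def c_def)
  have diffW: "(\<lambda>x. F n x - F m x) \<in> W" for m n by (intro energy.diff_closed F)
  have fast_\<Omega>: "L2_inner (lebesgue_on \<Omega>) (\<lambda>x. F n x - F m x) (\<lambda>x. F n x - F m x) \<le> C * (1/4) ^ m"
    if "m \<le> n" for m n
    using C(2)[OF diffW, of n m] mult_left_mono[OF fast[OF that] C(1)] by linarith
  have fast_\<mu>: "L2_inner \<mu> (\<lambda>x. F n x - F m x) (\<lambda>x. F n x - F m x) \<le> 1 * (1/4) ^ m"
    if "m \<le> n" for m n
    using parts(2)[OF diffW, of n m] fast[OF that] by simp
  have fast_\<I>: "L2_inner \<I> (\<lambda>z. difference_quotient s (F n) z - difference_quotient s (F m) z)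
      (\<lambda>z. difference_quotient s (F n) z - difference_quotient s (F m) z) \<le> (1 / c) * (1/4) ^ m"
    if "m \<le> n" for m n
    using order_trans[OF parts(1)[OF diffW] fast[OF that]] c
    by (simp add: difference_quotient_diff field_simps)
  define f where "f x = lim (\<lambda>n. F n x)" for x
  have f: "f \<in> borel_measurable lebesgue"
    unfolding f_def using W_D(1)[OF F] by (rule borel_measurable_lim_metric)
  have "AE x in lebesgue. convergent (\<lambda>n. F n x)"
    unfolding AE_lebesgue_iff
    using fast_Cauchy_AE_convergent[OF W_D(2)[OF F] fast_\<Omega> C(1)]
      fast_Cauchy_AE_convergent[OF W_D(3)[OF F] fast_\<mu>] by auto
  then have lim: "AE x in lebesgue. (\<lambda>n. F n x) \<longlonglongrightarrow> f x"
    by eventually_elim (simp add: f_def convergent_LIMSEQ_iff)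
  have f\<Omega>: "f \<in> borel_measurable (lebesgue_on \<Omega>)"
    using f by (rule measurable_restrict_space1)
  have f\<mu>: "f \<in> borel_measurable \<mu>"
    using measurable_restrict_space1[OF f, of "- \<Omega>"] by (simp add: robin_measure_def)
  have f\<I>: "difference_quotient s f \<in> borel_measurable \<I>"
    unfolding interaction_measure_def
    by (intro measurable_restrict_space1 borel_measurable_difference_quotient f)
  have "AE z in lebesgue \<Otimes>\<^sub>M lebesgue. (\<lambda>n. difference_quotient s (F n) z) \<longlonglongrightarrow> difference_quotient s f z"
    using AE_pair_fst_snd[OF lebesgue.sigma_finite_measure_axioms lim]
  proof eventually_elim
    case (elim z)
    have "(\<lambda>n. (F n (fst z) - F n (snd z)) * inverse (sqrt (norm (fst z - snd z) powr (real DIM('a) + 2 * s))))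
        \<longlonglongrightarrow> (f (fst z) - f (snd z)) * inverse (sqrt (norm (fst z - snd z) powr (real DIM('a) + 2 * s)))"
      using elim by (intro tendsto_mult tendsto_diff tendsto_const) auto
    then show ?case by (simp add: difference_quotient_def case_prod_beta divide_inverse)
  qed
  then have lim_\<I>: "AE z in \<I>. (\<lambda>n. difference_quotient s (F n) z) \<longlonglongrightarrow> difference_quotient s f z"
    unfolding interaction_measure_def using sets_interaction_region[OF \<Omega>(1)]
    by (subst AE_restrict_space_iff) (auto simp: space_pair_measure elim: eventually_mono)
  note lim' = lim[unfolded AE_lebesgue_iff]
  have 1: "f \<in> L2 (lebesgue_on \<Omega>)"
    by (rule L2_fast_Cauchy_AE_limit(1)[OF W_D(2)[OF F] f\<Omega> lim'[THEN conjunct1] fast_\<Omega> C(1)])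
  have 2: "f \<in> L2 \<mu>"
    by (rule L2_fast_Cauchy_AE_limit(1)[OF W_D(3)[OF F] f\<mu> lim'[THEN conjunct2] fast_\<mu>]) auto
  have dist_\<mu>: "L2_inner \<mu> (\<lambda>x. F m x - f x) (\<lambda>x. F m x - f x) \<le> 1 * (1/4) ^ m" for m
    by (rule L2_fast_Cauchy_AE_limit(2)[OF W_D(3)[OF F] f\<mu> lim'[THEN conjunct2] fast_\<mu>]) auto
  have 3: "difference_quotient s f \<in> L2 \<I>"
    by (rule L2_fast_Cauchy_AE_limit(1)[OF W_D(4)[OF F] f\<I> lim_\<I> fast_\<I>]) (use c in auto)
  have dist_\<I>: "L2_inner \<I> (\<lambda>z. difference_quotient s (F m) z - difference_quotient s f z)
      (\<lambda>z. difference_quotient s (F m) z - difference_quotient s f z) \<le> (1 / c) * (1/4) ^ m" for m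
    by (rule L2_fast_Cauchy_AE_limit(2)[OF W_D(4)[OF F] f\<I> lim_\<I> fast_\<I>]) (use c in auto)
  have fW: "f \<in> W" using f 1 2 3 by (simp add: robin_space_iff[OF \<Omega>(1)])
  have le: "\<E> (\<lambda>x. F m x - f x) (\<lambda>x. F m x - f x) \<le> 2 * (1/4) ^ m" for m
  proof -
    have "c * L2_inner \<I> (difference_quotient s (\<lambda>x. F m x - f x)) (difference_quotient s (\<lambda>x. F m x - f x))
        \<le> (1/4) ^ m"
      using mult_left_mono[OF dist_\<I>, of c m] c by (simp add: difference_quotient_diff)
    with dist_\<mu>[of m] show ?thesis by (simp add: robin_form_def c_def)
  qed
  have "(\<lambda>m. 2 * (1/4 :: real) ^ m) \<longlonglongrightarrow> 2 * 0"
    by (intro tendsto_mult tendsto_const LIMSEQ_power_zero) auto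
  then have bound_lim: "(\<lambda>m. 2 * (1/4 :: real) ^ m) \<longlonglongrightarrow> 0" by simp
  have "(\<lambda>n. \<E> (\<lambda>x. F n x - f x) (\<lambda>x. F n x - f x)) \<longlonglongrightarrow> 0"
    by (rule real_tendsto_sandwich[OF _ _ tendsto_const bound_lim])
      (auto intro!: always_eventually le energy.nonneg energy.diff_closed F fW)
  then show "\<exists>f\<in>W. (\<lambda>n. \<E> (\<lambda>x. F n x - f x) (\<lambda>x. F n x - f x)) \<longlonglongrightarrow> 0"
    using fW by blast
qed

text \<open>
  Riesz representation for the energy form.  The right-hand side is bounded by Cauchy-Schwarz and
  the Poincare inequality.
\<close>

theorem robin_weak_solution_exists:
  assumes w: "w \<in> L2 (lebesgue_on \<Omega>)" and z: "z \<in> L2 \<mu>"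
  shows "\<exists>u. robin_weak_solution s \<Omega> \<kappa> w z u"
proof -
  define L where "L v = L2_inner (lebesgue_on \<Omega>) w v + L2_inner \<mu> z v" for v
  obtain C where C: "0 \<le> C" "\<And>u. u \<in> W \<Longrightarrow> L2_inner (lebesgue_on \<Omega>) u u \<le> C * \<E> u u"
    by (rule energy_controls_L2) blast
  define B where "B = 2 * (L2_inner (lebesgue_on \<Omega>) w w * C + L2_inner \<mu> z z)"
  have bounded: "(L v)\<^sup>2 \<le> B * \<E> v v" if v: "v \<in> W" for v
  proof -
    have "L2_inner \<mu> v v \<le> \<E> v v"
      using L2.nonneg[OF W_D(4)[OF v]] frac_const_pos[OF s, of "DIM('a)"] by (simp add: robin_form_def)
    then have z': "(L2_inner \<mu> z v)\<^sup>2 \<le> L2_inner \<mu> z z * \<E> v v"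
      using L2.Cauchy_Schwarz[OF z W_D(3)[OF v]] mult_left_mono[OF _ L2.nonneg[OF z]] by fastforce
    have w': "(L2_inner (lebesgue_on \<Omega>) w v)\<^sup>2 \<le> L2_inner (lebesgue_on \<Omega>) w w * (C * \<E> v v)"
      using L2.Cauchy_Schwarz[OF w W_D(2)[OF v]] mult_left_mono[OF C(2)[OF v] L2.nonneg[OF w]] by linarith
    have "(x + y)\<^sup>2 \<le> 2 * (x\<^sup>2 + y\<^sup>2)" for x y :: real
      using zero_le_power2[of "x - y"] by (simp add: power2_eq_square algebra_simps)
    then have "(L v)\<^sup>2 \<le> 2 * ((L2_inner (lebesgue_on \<Omega>) w v)\<^sup>2 + (L2_inner \<mu> z v)\<^sup>2)"
      unfolding L_def .
    also have "\<dots> \<le> B * \<E> v v" using z' w' by (simp add: B_def algebra_simps)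
    finally show ?thesis .
  qed
  have "(\<lambda>_. 0) \<in> W" by (simp add: robin_space_iff[OF \<Omega>(1)] L2_def difference_quotient_def case_prod_beta)
  then have "W \<noteq> {}" by blast
  moreover have "L (\<lambda>x. f x + g x) = L f + L g" if "f \<in> W" "g \<in> W" for f g
    using W_D[OF that(1)] W_D[OF that(2)] w z by (simp add: L_def L2.add_right)
  moreover have "L (\<lambda>x. c * f x) = c * L f" if "f \<in> W" for f c
    using W_D[OF that] w z by (simp add: L_def L2.scale_right ring_distribs)
  ultimately obtain u where "u \<in> W" "\<And>v. v \<in> W \<Longrightarrow> \<E> u v = L v"
    using energy.Riesz_representation[of L B, OF _ robin_space_complete _ _ bounded] by blast
  then show ?thesis by (auto simp: robin_weak_solution_iff[OF \<Omega>(1)] L_def)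
qed

theorem robin_weak_solution_unique:
  assumes "robin_weak_solution s \<Omega> \<kappa> w z u" "robin_weak_solution s \<Omega> \<kappa> w z v"
  shows "AE x in lebesgue. u x = v x"
proof -
  have eq: "\<E> u h = \<E> v h" if "h \<in> W" for h
    using assms that by (auto simp: robin_weak_solution_iff[OF \<Omega>(1)])
  have uv: "u \<in> W" "v \<in> W" using assms by (auto simp: robin_weak_solution_def)
  have d: "(\<lambda>x. u x - v x) \<in> W" by (intro energy.diff_closed uv)
  have "\<E> (\<lambda>x. u x - v x) (\<lambda>x. u x - v x) = 0"
    using eq[OF d] by (simp add: energy.diff_left uv d)
  from AE_eq_0_if_energy_0[OF d this] show ?thesis by simp
qed

section \<open>Optimality conditions\<close>

abbreviation "S \<equiv> control_to_state s \<Omega> \<kappa>"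

lemma control_to_state_weak_solution:
  assumes "z \<in> L2 \<mu>"
  shows "robin_weak_solution s \<Omega> \<kappa> (\<lambda>_. 0) z (S z)"
  using robin_weak_solution_exists[OF zero_L2 assms] unfolding control_to_state_def by (rule someI_ex)

lemma control_to_state_in_W: "z \<in> L2 \<mu> \<Longrightarrow> S z \<in> W"
  using control_to_state_weak_solution by (auto simp: robin_weak_solution_def)

lemma control_to_state_energy:
  assumes "z \<in> L2 \<mu>" "v \<in> W"
  shows "\<E> (S z) v = L2_inner \<mu> z v"
  using control_to_state_weak_solution[OF assms(1)] assms(2)
  by (simp add: robin_weak_solution_iff[OF \<Omega>(1)] L2_inner_def)

text \<open>
  Equality holds only almost everywhere, because the state is chosen separately for each control.
\<close>

lemma control_to_state_affine:
  assumes z: "z \<in> L2 \<mu>" and y: "y \<in> L2 \<mu>"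
  shows "AE x in lebesgue_on \<Omega>. S (\<lambda>x. (1 - t) * z x + t * y x) x = S z x + t * (S y x - S z x)"
proof -
  let ?u = "\<lambda>x. S z x + t * (S y x - S z x)"
  have zt: "(\<lambda>x. (1 - t) * z x + t * y x) \<in> L2 \<mu>"
    by (intro L2_add L2_scale z y)
  note W = control_to_state_in_W[OF z] control_to_state_in_W[OF y]
  have "\<E> ?u v = L2_inner \<mu> (\<lambda>x. (1 - t) * z x + t * y x) v" if v: "v \<in> W" for v
    using W v W_D(3)[OF v] z y
    by (simp add: energy.bilinear L2.bilinear control_to_state_energy algebra_simps)
  moreover have "?u \<in> W" by (intro energy.add_closed energy.scale_closed energy.diff_closed W)
  ultimately have "robin_weak_solution s \<Omega> \<kappa> (\<lambda>_. 0) (\<lambda>x. (1 - t) * z x + t * y x) ?u"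
    by (simp add: robin_weak_solution_iff[OF \<Omega>(1)] L2_inner_def)
  from robin_weak_solution_unique[OF control_to_state_weak_solution[OF zt] this]
  show ?thesis by (simp add: AE_lebesgue_iff)
qed

text \<open>
  Both sides are the energy of \<open>p\<close> against \<open>S y - S z\<close>, computed once from the adjoint equation and
  once, by symmetry, from the state equations.
\<close>

lemma adjoint_identity:
  assumes p: "robin_weak_solution s \<Omega> \<kappa> w (\<lambda>_. 0) p" and z: "z \<in> L2 \<mu>" and y: "y \<in> L2 \<mu>"
  shows "L2_inner (lebesgue_on \<Omega>) w (\<lambda>x. S y x - S z x) = L2_inner \<mu> p (\<lambda>x. y x - z x)"
proof -
  note W = control_to_state_in_W[OF z] control_to_state_in_W[OF y]
  have pW: "p \<in> W" using p by (simp add: robin_weak_solution_def)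
  have "L2_inner (lebesgue_on \<Omega>) w (\<lambda>x. S y x - S z x) = \<E> p (\<lambda>x. S y x - S z x)"
    using p energy.diff_closed[OF W(2,1)] by (simp add: robin_weak_solution_iff[OF \<Omega>(1)] L2_inner_def)
  also have "\<dots> = \<E> (\<lambda>x. S y x - S z x) p"
    by (intro energy.sym pW energy.diff_closed W)
  also have "\<dots> = L2_inner \<mu> (\<lambda>x. y x - z x) p"
    using W_D(3)[OF pW] by (simp add: energy.diff_left W pW control_to_state_energy z y L2.diff_left)
  also have "\<dots> = L2_inner \<mu> p (\<lambda>x. y x - z x)"
    by (intro L2.sym L2.diff_closed z y W_D(3)[OF pW])
  finally show ?thesis .
qed

text \<open>
  Divide the increase of the cost along the segment from \<open>z\<close> to \<open>y\<close> by the parameter and pass to the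
  limit.  The derivative of \<open>J\<close> along the corresponding segment of states is expressed by the adjoint
  state.
\<close>

lemma minimizer_imp_optimality:
  assumes K: "K \<subseteq> L2 \<mu>" "L2_convex_set K"
    and J: "\<And>u. u \<in> L2 (lebesgue_on \<Omega>) \<Longrightarrow> has_L2_gradient (lebesgue_on \<Omega>) J (J' u) u"
    and p: "robin_weak_solution s \<Omega> \<kappa> (J' (S z)) (\<lambda>_. 0) p"
    and min: "is_minimizer_over K (reduced_cost s \<Omega> \<kappa> \<xi> J) z"
  shows "variational_inequality \<mu> K \<xi> p z"
proof -
  have zK: "z \<in> K" using min by (simp add: is_minimizer_over_def)
  have z: "z \<in> L2 \<mu>" using zK K by auto
  have pL2: "p \<in> L2 \<mu>" using p W_D(3) by (auto simp: robin_weak_solution_def)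
  note Sz = W_D(2)[OF control_to_state_in_W[OF z]]
  have "0 \<le> L2_inner \<mu> p (\<lambda>x. y x - z x) + \<xi> * L2_inner \<mu> z (\<lambda>x. y x - z x)" if yK: "y \<in> K" for y
  proof -
    have y: "y \<in> L2 \<mu>" using yK K by auto
    define h where "h = (\<lambda>x. y x - z x)"
    have h: "h \<in> L2 \<mu>" unfolding h_def by (intro L2.diff_closed y z)
    define d where "d = (\<lambda>x. S y x - S z x)"
    have d: "d \<in> L2 (lebesgue_on \<Omega>)"
      unfolding d_def by (intro L2.diff_closed W_D(2)[OF control_to_state_in_W] y z)
    have quotient: "0 \<le> (J (\<lambda>x. S z x + t * d x) - J (S z)) / t + \<xi> * L2_inner \<mu> z h + \<xi> / 2 * t * L2_inner \<mu> h h"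
      if t: "t \<in> {0<..<1}" for t
    proof -
      define zt where "zt = (\<lambda>x. (1 - t) * z x + t * y x)"
      have ztK: "zt \<in> K" using K(2) zK yK t unfolding L2_convex_set_def zt_def by auto
      then have zt: "zt \<in> L2 \<mu>" using K by auto
      have zt_eq: "zt = (\<lambda>x. z x + t * h x)" by (auto simp: zt_def h_def algebra_simps)
      have utL2: "(\<lambda>x. S z x + t * d x) \<in> L2 (lebesgue_on \<Omega>)" by (intro L2_add L2_scale Sz d)
      have "AE x in lebesgue_on \<Omega>. S zt x = S z x + t * d x"
        using control_to_state_affine[OF z y, of t] by (simp add: zt_def d_def)
      then have "J (S zt) = J (\<lambda>x. S z x + t * d x)"
        by (rule has_L2_gradient_cong_AE[OF J[OF utL2] utL2 W_D(2)[OF control_to_state_in_W[OF zt]]])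
      moreover have "(L2_norm \<mu> zt)\<^sup>2 = (L2_norm \<mu> z)\<^sup>2 + t * (2 * L2_inner \<mu> z h + t * L2_inner \<mu> h h)"
        using z h L2.sym[OF h z] by (simp add: L2_norm_square zt_eq L2.bilinear algebra_simps)
      moreover have "reduced_cost s \<Omega> \<kappa> \<xi> J z \<le> reduced_cost s \<Omega> \<kappa> \<xi> J zt"
        using min ztK by (simp add: is_minimizer_over_def)
      ultimately have "0 \<le> J (\<lambda>x. S z x + t * d x) - J (S z)
          + \<xi> / 2 * (t * (2 * L2_inner \<mu> z h + t * L2_inner \<mu> h h))"
        by (simp add: reduced_cost_def ring_distribs)
      then have "0 \<le> (J (\<lambda>x. S z x + t * d x) - J (S z)
          + \<xi> / 2 * (t * (2 * L2_inner \<mu> z h + t * L2_inner \<mu> h h))) / t"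
        using t by (intro divide_nonneg_nonneg) auto
      also have "\<dots> = (J (\<lambda>x. S z x + t * d x) - J (S z)) / t + \<xi> * L2_inner \<mu> z h + \<xi> / 2 * t * L2_inner \<mu> h h"
        using t by (simp add: field_simps)
      finally show ?thesis .
    qed
    have "((\<lambda>t. (J (\<lambda>x. S z x + t * d x) - J (S z)) / t + \<xi> * L2_inner \<mu> z h + \<xi> / 2 * t * L2_inner \<mu> h h)
        \<longlongrightarrow> L2_inner (lebesgue_on \<Omega>) (J' (S z)) d + \<xi> * L2_inner \<mu> z h + \<xi> / 2 * 0 * L2_inner \<mu> h h) (at_right 0)"
      by (intro tendsto_intros has_L2_gradient_directional_derivative[OF J[OF Sz] d])
    then have "0 \<le> L2_inner (lebesgue_on \<Omega>) (J' (S z)) d + \<xi> * L2_inner \<mu> z h + \<xi> / 2 * 0 * L2_inner \<mu> h h"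
      by (rule tendsto_lowerbound)
        (use eventually_at_right_real[OF zero_less_one] quotient in \<open>auto elim: eventually_mono\<close>)
    also have "L2_inner (lebesgue_on \<Omega>) (J' (S z)) d = L2_inner \<mu> p h"
      unfolding d_def h_def by (rule adjoint_identity[OF p z y])
    finally show ?thesis by (simp add: h_def)
  qed
  then show ?thesis by (simp add: variational_inequality_iff pL2 z K)
qed

text \<open>
  Both parts of the cost lie above their tangents at \<open>z\<close>; the sum of the tangent increments is the
  quantity in the variational inequality.
\<close>

lemma optimality_imp_minimizer:
  assumes K: "K \<subseteq> L2 \<mu>" and zK: "z \<in> K"
    and J: "\<And>u. u \<in> L2 (lebesgue_on \<Omega>) \<Longrightarrow> has_L2_gradient (lebesgue_on \<Omega>) J (J' u) u"
    and p: "robin_weak_solution s \<Omega> \<kappa> (J' (S z)) (\<lambda>_. 0) p"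
    and conv: "L2_convex_fun (lebesgue_on \<Omega>) J" and \<xi>: "0 < \<xi>"
    and vi: "variational_inequality \<mu> K \<xi> p z"
  shows "is_minimizer_over K (reduced_cost s \<Omega> \<kappa> \<xi> J) z"
  unfolding is_minimizer_over_def
proof (intro conjI ballI zK)
  fix y assume yK: "y \<in> K"
  have z: "z \<in> L2 \<mu>" and y: "y \<in> L2 \<mu>" using zK yK K by auto
  have pL2: "p \<in> L2 \<mu>" using p W_D(3) by (auto simp: robin_weak_solution_def)
  note S = W_D(2)[OF control_to_state_in_W[OF z]] W_D(2)[OF control_to_state_in_W[OF y]]
  have "J (S z) + L2_inner (lebesgue_on \<Omega>) (J' (S z)) (\<lambda>x. S y x - S z x) \<le> J (S y)"
    using convex_fun_ge_tangent[OF J[OF S(1)] S(1) L2.diff_closed[OF S(2,1)] conv] by simp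
  then have 1: "J (S z) + L2_inner \<mu> p (\<lambda>x. y x - z x) \<le> J (S y)"
    by (simp add: adjoint_identity[OF p z y])
  have "0 \<le> L2_inner \<mu> p (\<lambda>x. y x - z x) + \<xi> * L2_inner \<mu> z (\<lambda>x. y x - z x)"
    using vi yK by (simp add: variational_inequality_iff pL2 z K)
  moreover have "L2_inner \<mu> z (\<lambda>x. y x - z x) \<le> (L2_inner \<mu> y y - L2_inner \<mu> z z) / 2"
    using L2.nonneg[OF L2.diff_closed[OF y z]] L2.sym[OF y z]
    by (simp add: L2.bilinear y z)
  then have "\<xi> * L2_inner \<mu> z (\<lambda>x. y x - z x) \<le> \<xi> * ((L2_inner \<mu> y y - L2_inner \<mu> z z) / 2)"
    using \<xi> by (intro mult_left_mono) auto
  ultimately show "reduced_cost s \<Omega> \<kappa> \<xi> J z \<le> reduced_cost s \<Omega> \<kappa> \<xi> J y"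
    using 1 by (simp add: reduced_cost_def L2_norm_square right_diff_distrib diff_divide_distrib)
qed

end

theorem theorem5p3:
  fixes s \<xi> :: real
    and \<Omega> :: "(real ^ 'n) set"
    and \<kappa> :: "real ^ 'n \<Rightarrow> real"
    and Zad Z :: "(real ^ 'n \<Rightarrow> real) set"
    and J :: "(real ^ 'n \<Rightarrow> real) \<Rightarrow> real"
    and J' :: "(real ^ 'n \<Rightarrow> real) \<Rightarrow> (real ^ 'n \<Rightarrow> real)"
    and zbar :: "real ^ 'n \<Rightarrow> real"
  assumes "0 < s" and "s < 1"
    and "open \<Omega>" and "connected \<Omega>" and "\<Omega> \<noteq> {}" and "bounded \<Omega>" and "lipschitz_boundary \<Omega>"
    and "integrable (lebesgue_on (- \<Omega>)) \<kappa>"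
    and "\<exists>C. AE x in lebesgue_on (- \<Omega>). \<bar>\<kappa> x\<bar> \<le> C"
    and "AE x in lebesgue_on (- \<Omega>). 0 < \<kappa> x"
    and "0 < \<xi>"
    and "closedin (L2_topology (robin_measure \<Omega> \<kappa>)) Zad"
    and "L2_convex_set Zad"
    and "L2_weakly_lsc (lebesgue_on \<Omega>) J"
    and "openin (L2_topology (robin_measure \<Omega> \<kappa>)) Z"
    and "Zad \<subseteq> Z"
    and "L2_C1_with_gradient (lebesgue_on \<Omega>) J J'"
    and "zbar \<in> Zad"
  shows "\<exists>p.
     robin_weak_solution s \<Omega> \<kappa> (J' (control_to_state s \<Omega> \<kappa> zbar)) (\<lambda>_. 0) p \<and>
     (\<forall>q. robin_weak_solution s \<Omega> \<kappa> (J' (control_to_state s \<Omega> \<kappa> zbar)) (\<lambda>_. 0) q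
          \<longrightarrow> (AE x in lebesgue. q x = p x)) \<and>
     (is_minimizer_over Zad (reduced_cost s \<Omega> \<kappa> \<xi> J) zbar
        \<longrightarrow> variational_inequality (robin_measure \<Omega> \<kappa>) Zad \<xi> p zbar) \<and>
     (variational_inequality (robin_measure \<Omega> \<kappa>) Zad \<xi> p zbar
        \<longleftrightarrow> (AE x in robin_measure \<Omega> \<kappa>.
               zbar x = L2_proj (robin_measure \<Omega> \<kappa>) Zad (\<lambda>x. - p x / \<xi>) x)) \<and>
     (L2_convex_fun (lebesgue_on \<Omega>) J \<and>
      variational_inequality (robin_measure \<Omega> \<kappa>) Zad \<xi> p zbar
        \<longrightarrow> is_minimizer_over Zad (reduced_cost s \<Omega> \<kappa> \<xi> J) zbar)"
proof -
  interpret robin_setting s \<Omega> \<kappa>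
    using assms by unfold_locales (auto intro: borel_measurable_integrable)
  have J: "has_L2_gradient (lebesgue_on \<Omega>) J (J' u) u" if "u \<in> L2 (lebesgue_on \<Omega>)" for u
    using \<open>L2_C1_with_gradient (lebesgue_on \<Omega>) J J'\<close> that by (simp add: L2_C1_with_gradient_def)
  have Zad: "Zad \<subseteq> L2 \<mu>"
    by (rule closedin_L2_subset) fact
  then have "S zbar \<in> L2 (lebesgue_on \<Omega>)"
    using \<open>zbar \<in> Zad\<close> by (auto intro: W_D(2) control_to_state_in_W)
  then have "J' (S zbar) \<in> L2 (lebesgue_on \<Omega>)"
    using J by (auto simp: has_L2_gradient_def)
  then obtain p where p: "robin_weak_solution s \<Omega> \<kappa> (J' (S zbar)) (\<lambda>_. 0) p"
    using robin_weak_solution_exists zero_L2 by blast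
  then have "p \<in> L2 \<mu>" by (auto simp: robin_weak_solution_def intro: W_D(3))
  show ?thesis
  proof (intro exI[of _ p] conjI allI impI p)
    show "AE x in lebesgue. q x = p x"
      if "robin_weak_solution s \<Omega> \<kappa> (J' (S zbar)) (\<lambda>_. 0) q" for q
      by (rule robin_weak_solution_unique[OF that p])
    show "variational_inequality \<mu> Zad \<xi> p zbar"
      if "is_minimizer_over Zad (reduced_cost s \<Omega> \<kappa> \<xi> J) zbar"
      by (rule minimizer_imp_optimality[where J' = J', OF Zad \<open>L2_convex_set Zad\<close> J p that])
    show "variational_inequality \<mu> Zad \<xi> p zbar \<longleftrightarrow>
        (AE x in \<mu>. zbar x = L2_proj \<mu> Zad (\<lambda>x. - p x / \<xi>) x)"
      by (rule optimality_iff_projection) fact+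
    show "is_minimizer_over Zad (reduced_cost s \<Omega> \<kappa> \<xi> J) zbar"
      if "L2_convex_fun (lebesgue_on \<Omega>) J \<and> variational_inequality \<mu> Zad \<xi> p zbar"
      using optimality_imp_minimizer[where J' = J', OF Zad \<open>zbar \<in> Zad\<close> J p _ \<open>0 < \<xi>\<close>] that
      by blast
  qed
qed

end
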